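(* Suppose that $\lambda$ is a partition of $n$ and $T$ is a standard $\lambda$-tableau. Let $\sigma_k=j-i$ if $k$ occupies the box $(i,j)$ in $T$. Then the consecutive evaluations give $$\Omega_{\omega}(v_1,\dots,v_n)\big|_{v_1=\sigma_1}\big|_{v_2=\sigma_2}\dots\big|_{v_n=\sigma_n}=\frac{2^n\,C_{\lambda}(\omega/4)\,H(\lambda)}{C_{\lambda}(\omega/2)}\,E_T,$$ where $H(\lambda)$ is the product of the hooks of $\lambda$ and $E_T$ is the primitive idempotent in $\mathbb{C}[\mathfrak{S}_n]$ associated with $T$.
   Context: $\omega$ is an indeterminate parameter (so coefficients are in $\mathbb{C}(\omega)$), $\mathfrak{S}_n$ is the symmetric group and $s_{ij}=(i,j)$ denotes the transposition. Define the rational function in $v_1,\dots,v_n$ with values in the group algebra of $\mathfrak{S}_n$ $$\Omega_{\omega}(v_1,\dots,v_n)=\prod_{1\leqslant i<j\leqslant n}\Big(1+\frac{s_{ij}}{v_i+v_j+\omega/2}\Big)\prod_{1\leqslant i<j\leqslant n}\Big(1-\frac{s_{ij}}{v_i-v_j}\Big),$$ with both products taken (left to right) in the lexicographic order on the pairs $(i,j)$. Consecutive evaluations means that one first sets $v_1=\sigma_1$, then sets $v_2=\sigma_2$ in the resulting (simplified) rational function of $v_2,\dots,v_n$, and so on. Partitions are identified with Young diagrams, $(i,j)$ being the box in row $i$, column $j$. The content polynomial is $C_\lambda(z)=\prod_{\alpha\in\lambda}(z+\sigma(\alpha))$, where $\sigma(\alpha)=j-i$ if $\alpha=(i,j)$.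 The primitive idempotent $E_T$ is the one corresponding to the diagonal matrix unit indexed by $T$ (Young's seminormal form). Explicitly, with Jucys--Murphy elements $x_r=\sum_{i=1}^{r-1}s_{ir}$: $E_T=1$ for $n=1$, and for $n\geqslant2$, if $U$ is the standard tableau obtained from $T$ by removing the box $\alpha$ occupied by $n$ and $\mu$ is the shape of $U$, then $$E_T=E_U\,\frac{(x_n-a_1)\cdots(x_n-a_k)}{(\sigma_n-a_1)\cdots(\sigma_n-a_k)},$$ where $a_1,\dots,a_k$ are the values $j-i$ for all boxes $(i,j)$, excluding $\alpha$, which can be added to $\mu$ to get a diagram. *)

theory Defs
  imports
    Complex_Main
    "HOL-Library.Poly_Mapping"
    "HOL-Combinatorics.Perm"
    "HOL-Computational_Algebra.Polynomial_Factorial"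
begin

section \<open>Group algebras of symmetric groups\<close>

text \<open>
  The type \<^typ>\<open>nat perm\<close> is the group of finitely supported permutations of the naturals, and
  the symmetric group on \<open>{1..n}\<close> is its subgroup fixing all other points.  The convolution product
  of \<^theory>\<open>HOL-Library.Poly_Mapping\<close> expects the monoid of exponents to be written additively,
  so the (non-commutative) group law is copied to the additive symbols.
\<close>

instantiation Perm.perm :: (type) group_add
begin

definition zero_perm :: "'a perm" where "zero_perm = 1"
definition plus_perm :: "'a perm \<Rightarrow> 'a perm \<Rightarrow> 'a perm" where "plus_perm p q = p * q"
definition uminus_perm :: "'a perm \<Rightarrow> 'a perm" where "uminus_perm p = inverse p"
definition minus_perm :: "'a perm \<Rightarrow> 'a perm \<Rightarrow> 'a perm" where "minus_perm p q = p * inverse q"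

instance
  by standard
    (simp_all add: zero_perm_def plus_perm_def uminus_perm_def minus_perm_def mult.assoc)

end

type_synonym 'k group_algebra = "nat perm \<Rightarrow>\<^sub>0 'k"

definition scalar :: "'k::zero \<Rightarrow> 'k group_algebra" where
  "scalar c = Poly_Mapping.single 0 c"

definition transp :: "nat \<Rightarrow> nat \<Rightarrow> 'k::zero_neq_one group_algebra" where
  "transp i j = Poly_Mapping.single (Perm.swap i j) 1"


section \<open>Rational functions and consecutive evaluation\<close>

type_synonym cfield = "complex poly fract"
type_synonym mpol = "(nat \<Rightarrow>\<^sub>0 nat) \<Rightarrow>\<^sub>0 cfield"
type_synonym ratfun = "mpol fract"

definition omega :: cfield where
  "omega = to_fract [:0, 1:]"

definition cfield_of_complex :: "complex \<Rightarrow> cfield" where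
  "cfield_of_complex z = to_fract [:z:]"

definition ratfun_of_cfield :: "cfield \<Rightarrow> ratfun" where
  "ratfun_of_cfield c = to_fract (Poly_Mapping.single 0 c)"

definition var :: "nat \<Rightarrow> ratfun" where
  "var i = to_fract (Poly_Mapping.single (Poly_Mapping.single i 1) 1)"

definition subst_var :: "nat \<Rightarrow> cfield \<Rightarrow> mpol \<Rightarrow> mpol" where
  "subst_var k c P = (\<Sum>m\<in>Poly_Mapping.keys P.
     Poly_Mapping.single (Poly_Mapping.update k 0 m)
       (Poly_Mapping.lookup P m * c ^ Poly_Mapping.lookup m k))"

text \<open>
  \<open>evaluates_to k c f g\<close> says that \<open>f\<close> is regular at \<open>v\<^sub>k = c\<close>, i.e. can be written as a fraction
  whose denominator does not vanish identically there, and that its restriction is \<open>g\<close>;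
  by \<open>evaluates_to_unique\<close> below, \<open>g\<close> does not depend on the fraction chosen.
\<close>

definition evaluates_to :: "nat \<Rightarrow> cfield \<Rightarrow> ratfun \<Rightarrow> ratfun \<Rightarrow> bool" where
  "evaluates_to k c f g \<longleftrightarrow> (\<exists>P Q. subst_var k c Q \<noteq> 0 \<and> f = Fract P Q \<and>
     g = Fract (subst_var k c P) (subst_var k c Q))"

definition ga_evaluates_to ::
  "nat \<Rightarrow> cfield \<Rightarrow> ratfun group_algebra \<Rightarrow> ratfun group_algebra \<Rightarrow> bool" where
  "ga_evaluates_to k c X Y \<longleftrightarrow>
     (\<forall>p. evaluates_to k c (Poly_Mapping.lookup X p) (Poly_Mapping.lookup Y p))"

primrec consecutive_evaluation ::
  "(nat \<times> cfield) list \<Rightarrow> ratfun group_algebra \<Rightarrow> ratfun group_algebra \<Rightarrow> bool" where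
  "consecutive_evaluation [] X Y \<longleftrightarrow> X = Y"
| "consecutive_evaluation (kc # kcs) X Y \<longleftrightarrow>
     (\<exists>Z. ga_evaluates_to (fst kc) (snd kc) X Z \<and> consecutive_evaluation kcs Z Y)"

lemma subst_var_superset:
  assumes "finite A" "Poly_Mapping.keys P \<subseteq> A"
  shows "subst_var k c P = (\<Sum>m\<in>A. Poly_Mapping.single (Poly_Mapping.update k 0 m)
       (Poly_Mapping.lookup P m * c ^ Poly_Mapping.lookup m k))"
  unfolding subst_var_def using assms
  by (intro sum.mono_neutral_left) (auto simp: in_keys_iff)

lemma subst_var_zero [simp]: "subst_var k c 0 = 0"
  by (simp add: subst_var_def)

lemma subst_var_add: "subst_var k c (P + Q) = subst_var k c P + subst_var k c Q"
proof -
  let ?A = "Poly_Mapping.keys P \<union> Poly_Mapping.keys Q"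
  have "finite ?A" "Poly_Mapping.keys (P + Q) \<subseteq> ?A"
    by (simp_all add: Poly_Mapping.keys_add)
  then show ?thesis
    by (subst (1 2 3) subst_var_superset[of ?A])
       (auto simp: lookup_add single_add algebra_simps sum.distrib)
qed

lemma subst_var_single:
  "subst_var k c (Poly_Mapping.single m x) =
     Poly_Mapping.single (Poly_Mapping.update k 0 m) (x * c ^ Poly_Mapping.lookup m k)"
  by (subst subst_var_superset[of "{m}"]) auto

lemma subst_var_sum: "subst_var k c (\<Sum>i\<in>A. f i) = (\<Sum>i\<in>A. subst_var k c (f i))"
  by (induction A rule: infinite_finite_induct) (auto simp: subst_var_add)

lemma update_zero_add:
  fixes m m' :: "nat \<Rightarrow>\<^sub>0 nat"
  shows "Poly_Mapping.update k 0 (m + m') = Poly_Mapping.update k 0 m + Poly_Mapping.update k 0 m'"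
  by (rule poly_mapping_eqI) (auto simp: lookup_update lookup_add)

lemma sum_singles: "P = (\<Sum>m\<in>Poly_Mapping.keys P. Poly_Mapping.single m (Poly_Mapping.lookup P m))"
  by (rule poly_mapping_eqI)
     (auto simp: lookup_sum lookup_single when_def in_keys_iff sum.delta)

lemma subst_var_mult: "subst_var k c (P * Q) = subst_var k c P * subst_var k c Q"
proof -
  have "subst_var k c (P * Q) = subst_var k c
      ((\<Sum>m\<in>Poly_Mapping.keys P. Poly_Mapping.single m (Poly_Mapping.lookup P m)) *
       (\<Sum>m\<in>Poly_Mapping.keys Q. Poly_Mapping.single m (Poly_Mapping.lookup Q m)))"
    by (simp flip: sum_singles)
  also have "\<dots> = subst_var k c P * subst_var k c Q"
    unfolding sum_product subst_var_sum mult_single subst_var_single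
    by (simp add: subst_var_def sum_product mult_single update_zero_add lookup_add
        power_add algebra_simps)
  finally show ?thesis .
qed

lemma evaluates_to_unique:
  assumes "evaluates_to k c f g" "evaluates_to k c f g'"
  shows "g = g'"
proof -
  obtain P Q where *: "subst_var k c Q \<noteq> 0" "f = Fract P Q"
      "g = Fract (subst_var k c P) (subst_var k c Q)"
    using assms(1) by (auto simp: evaluates_to_def)
  obtain P' Q' where **: "subst_var k c Q' \<noteq> 0" "f = Fract P' Q'"
      "g' = Fract (subst_var k c P') (subst_var k c Q')"
    using assms(2) by (auto simp: evaluates_to_def)
  have "Q \<noteq> 0" "Q' \<noteq> 0" using * ** by auto
  then have "P * Q' = P' * Q" using * ** by (simp add: eq_fract)
  then have "subst_var k c (P * Q') = subst_var k c (P' * Q)" by simp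
  then show ?thesis using * ** by (simp add: eq_fract subst_var_mult)
qed

lemma consecutive_evaluation_unique:
  "consecutive_evaluation kcs X Y \<Longrightarrow> consecutive_evaluation kcs X Y' \<Longrightarrow> Y = Y'"
proof (induction kcs arbitrary: X)
  case (Cons kc kcs)
  then show ?case
    by (auto simp: ga_evaluates_to_def)
       (metis evaluates_to_unique poly_mapping_eqI)
qed auto


section \<open>The function \<open>\<Omega>\<^sub>\<omega>\<close>\<close>

definition lex_pairs :: "nat \<Rightarrow> (nat \<times> nat) list" where
  "lex_pairs n = [(i, j). i \<leftarrow> [1..<n+1], j \<leftarrow> [i+1..<n+1]]"

definition Omega :: "nat \<Rightarrow> ratfun group_algebra" where
  "Omega n =
     prod_list (map (\<lambda>(i, j). 1 + scalar (1 / (var i + var j + ratfun_of_cfield (omega / 2))) * transp i j)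
       (lex_pairs n)) *
     prod_list (map (\<lambda>(i, j). 1 - scalar (1 / (var i - var j)) * transp i j)
       (lex_pairs n))"


section \<open>Partitions, diagrams and tableaux\<close>

type_synonym box = "nat \<times> nat"

definition is_partition :: "nat list \<Rightarrow> bool" where
  "is_partition lam \<longleftrightarrow> sorted_wrt (\<ge>) lam \<and> 0 \<notin> set lam"

definition partition_of :: "nat \<Rightarrow> nat list \<Rightarrow> bool" where
  "partition_of n lam \<longleftrightarrow> is_partition lam \<and> sum_list lam = n"

text \<open>Rows and columns are numbered from 1, while list positions start at 0.\<close>

definition diagram :: "nat list \<Rightarrow> box set" where
  "diagram lam = {(i, j). 1 \<le> i \<and> i \<le> length lam \<and> 1 \<le> j \<and> j \<le> lam ! (i - 1)}"

definition is_diagram :: "box set \<Rightarrow> bool" where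
  "is_diagram D \<longleftrightarrow> (\<exists>lam. is_partition lam \<and> D = diagram lam)"

definition addable :: "box set \<Rightarrow> box set" where
  "addable D = {b. b \<notin> D \<and> is_diagram (insert b D)}"

fun content :: "box \<Rightarrow> int" where
  "content (i, j) = int j - int i"

definition content_poly :: "box set \<Rightarrow> 'a::comm_ring_1 \<Rightarrow> 'a" where
  "content_poly D z = (\<Prod>b\<in>D. z + of_int (content b))"

fun hook_length :: "box set \<Rightarrow> box \<Rightarrow> nat" where
  "hook_length D (i, j) =
     card {(i', j') \<in> D. (i' = i \<and> j \<le> j') \<or> (j' = j \<and> i \<le> i')}"

definition hook_product :: "box set \<Rightarrow> nat" where
  "hook_product D = (\<Prod>b\<in>D. hook_length D b)"

text \<open>A tableau is a function on boxes, of which only the values on the diagram matter.\<close>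

definition standard_tableau :: "nat \<Rightarrow> box set \<Rightarrow> (box \<Rightarrow> nat) \<Rightarrow> bool" where
  "standard_tableau n D T \<longleftrightarrow> bij_betw T D {1..n} \<and>
     (\<forall>i j j'. (i, j) \<in> D \<and> (i, j') \<in> D \<and> j < j' \<longrightarrow> T (i, j) < T (i, j')) \<and>
     (\<forall>i i' j. (i, j) \<in> D \<and> (i', j) \<in> D \<and> i < i' \<longrightarrow> T (i, j) < T (i', j))"


section \<open>The primitive idempotents\<close>

definition jucys_murphy :: "nat \<Rightarrow> complex group_algebra" where
  "jucys_murphy r = (\<Sum>i\<in>{1..<r}. transp i r)"

text \<open>
  \<open>seminormal_idem n D T\<close> is \<open>E\<^sub>T\<close> for a standard tableau \<open>T\<close> with \<open>n\<close> boxes and shape \<open>D\<close>; the tableau \<open>U\<close>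
  is the restriction of \<open>T\<close> to the diagram without the box of the largest entry.  Distinct addable
  boxes of a diagram have distinct contents, so the \<open>a\<^sub>i\<close> may be collected in a set; the factors
  commute, so their order is immaterial.  The recursion starts at \<open>n = 0\<close>: for \<open>n = 1\<close> there are no
  \<open>a\<^sub>i\<close>, the only addable box of the empty diagram being \<open>\<alpha>\<close> itself, and the value is again 1.
\<close>

primrec seminormal_idem :: "nat \<Rightarrow> box set \<Rightarrow> (box \<Rightarrow> nat) \<Rightarrow> complex group_algebra" where
  "seminormal_idem 0 D T = 1"
| "seminormal_idem (Suc m) D T =
     (let \<alpha> = the_inv_into D T (Suc m);
          M = D - {\<alpha>};
          as = sorted_list_of_set (content ` (addable M - {\<alpha>}))
      in seminormal_idem m M T *
         prod_list (map (\<lambda>a. jucys_murphy (Suc m) - of_int a) as) *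
         scalar (1 / prod_list (map (\<lambda>a. of_int (content \<alpha> - a)) as)))"

end

theory Submission
  imports Defs "HOL-Computational_Algebra.Fundamental_Theorem_Algebra"
begin

text \<open>
  Write \<open>x\<^sub>k\<close> for the Jucys--Murphy element \<open>\<Sum>\<^sub>i\<^sub><\<^sub>k s\<^sub>i\<^sub>k\<close>.  Sorting the factors by their larger index does not
  change a lexicographic product (\<open>lex_product_by_columns\<close>), so both products in \<open>\<Omega>\<close> are products of
  columns, the \<open>n\<close>-th column consisting of the factors with \<open>s\<^sub>1\<^sub>n, \<dots>, s\<^sub>n\<^sub>-\<^sub>1\<^sub>n\<close>.

  Everything rests on one computation.  If \<open>E x\<^sub>i = \<sigma>\<^sub>i E\<close> for all \<open>i < n\<close>, and \<open>R(u)\<close> is the \<open>n\<close>-th column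
  \<open>\<Prod>\<^sub>i (1 - s\<^sub>i\<^sub>n / (\<sigma>\<^sub>i - u))\<close>, then
  \<open>E (u - x\<^sub>n) R(u) = f(u) E\<close> with \<open>f(u) = u \<Prod>\<^sub>i (1 - 1 / (u - \<sigma>\<^sub>i)\<^sup>2)\<close> (\<open>weight_times_column\<close>): up to a
  scalar function, a column is the resolvent of \<open>x\<^sub>n\<close>.  Three consequences are drawn.

  (1) The characteristic identity \<open>E\<^sub>U \<Prod>\<^sub>a (x\<^sub>n - a) = 0\<close>, the product over the contents \<open>a\<close> of the addable
  boxes of the shape \<open>\<mu>\<close> of \<open>U\<close> (\<open>characteristic_identity\<close>).  Let \<open>\<tau>\<close>
  be the coefficient of the neutral element.  A nonempty product of distinct \<open>s\<^sub>i\<^sub>n\<close> never fixes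
  \<open>n\<close>, whence \<open>\<tau> (E\<^sub>U R(u)) = \<tau> (E\<^sub>U)\<close>, and \<open>\<tau> (E\<^sub>U) / f(u)\<close> is the generating function of the moments
  \<open>\<tau> (E\<^sub>U x\<^sub>n\<^sup>k)\<close>.  Telescoping over the rows of \<open>\<mu>\<close> gives \<open>1 / f = h / g\<close> with \<open>g(u) = \<Prod>\<^sub>a (u - a)\<close> and a
  polynomial \<open>h\<close> (\<open>content_function_addable\<close>).  Hence \<open>\<tau> (E\<^sub>U g(x\<^sub>n) q(x\<^sub>n)) = 0\<close> for every \<open>q\<close>, in
  particular for \<open>q = g\<close>; as \<open>E\<^sub>U\<close> and \<open>x\<^sub>n\<close> are self-adjoint and \<open>\<tau> (X X\<^sup>*)\<close> is positive definite, this
  means \<open>E\<^sub>U g(x\<^sub>n) = 0\<close>.  By induction the \<open>E\<^sub>T\<close> are self-adjoint idempotents with \<open>E\<^sub>T x\<^sub>k = \<sigma>\<^sub>k E\<^sub>T\<close>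
  (\<open>seminormal_weight_idempotent\<close>).

  (2) The fusion of the second product.  Let \<open>c = \<sigma>\<^sub>n\<close> be the content of the box added to \<open>\<mu>\<close>.  The
  characteristic identity turns \<open>E\<^sub>U R(u)\<close> into \<open>f(u) / (u - c)\<close> times an expression that is regular at \<open>u = c\<close>
  with value \<open>E\<^sub>T\<close> (\<open>weight_times_column_regular\<close>).  The function \<open>f(u) / (u - c)\<close> is also regular
  there: splitting \<open>\<mu>\<close> into the boxes below, the boxes to the right, and the rectangle spanned by the new
  box shows that its value is \<open>H(\<lambda>) / H(\<mu>)\<close> (\<open>cofactor_at_content\<close>).  So evaluating \<open>v\<^sub>n\<close> replaces
  \<open>H(\<mu>) E\<^sub>U R(v\<^sub>n)\<close> by \<open>H(\<lambda>) E\<^sub>T\<close> (\<open>fusion_step\<close>).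

  (3) The first product is regular at all the points in question and acts on \<open>E\<^sub>T\<close> by a scalar: by the mirror
  image of the computation (\<open>product_times_weight\<close>), the \<open>k\<close>-th column multiplies \<open>E\<^sub>T\<close> by
  \<open>(2 \<sigma>\<^sub>k + \<omega>/2) / (\<sigma>\<^sub>k + \<omega>/2)\<close>, and these scalars multiply up to \<open>2\<^sup>n C\<^sub>\<lambda>(\<omega>/4) / C\<^sub>\<lambda>(\<omega>/2)\<close>.
\<close>


section \<open>The group algebra\<close>

subsection \<open>Scalars, transpositions and extension of scalars\<close>

lemma scalar_0 [simp]: "scalar 0 = 0"
  by (simp add: scalar_def)

lemma scalar_1 [simp]: "scalar 1 = 1"
  by (simp add: scalar_def)

lemma scalar_add: "scalar (a + b) = scalar a + scalar b"
  by (simp add: scalar_def single_add)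

lemma scalar_uminus: "scalar (- a) = - scalar a"
  by (simp add: scalar_def single_uminus)

lemma scalar_diff: "scalar (a - b) = scalar a - scalar b"
  by (simp add: scalar_def single_diff)

lemma scalar_mult: "scalar (a * b) = scalar a * scalar b"
  by (simp add: scalar_def mult_single)

lemma scalar_of_int: "scalar (of_int z) = of_int z"
  by (simp add: scalar_def)

lemma scalar_mult_expand:
  fixes X :: "'k::comm_ring_1 group_algebra"
  shows "scalar c * X =
    (\<Sum>p\<in>Poly_Mapping.keys X. Poly_Mapping.single p (c * Poly_Mapping.lookup X p))"
  by (subst sum_singles[of X]) (simp add: sum_distrib_left scalar_def mult_single)

lemma scalar_commute:
  fixes X :: "'k::comm_ring_1 group_algebra"
  shows "X * scalar c = scalar c * X"
  unfolding scalar_mult_expand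
  by (subst sum_singles[of X]) (simp add: sum_distrib_right scalar_def mult_single mult.commute)

lemma scalar_left_commute:
  fixes X :: "'k::comm_ring_1 group_algebra"
  shows "X * (scalar c * Y) = scalar c * (X * Y)"
  by (metis mult.assoc scalar_commute)

lemma lookup_scalar_mult [simp]:
  fixes X :: "'k::comm_ring_1 group_algebra"
  shows "Poly_Mapping.lookup (scalar c * X) p = c * Poly_Mapping.lookup X p"
  unfolding scalar_mult_expand
  by (auto simp: lookup_sum lookup_single when_def sum.delta in_keys_iff)

text \<open>
  Identities between rational multiples are proved below by clearing a denominator.
\<close>

lemma scalar_cancel:
  fixes X :: "'k::field group_algebra"
  assumes "scalar c * X = scalar c * Y" "c \<noteq> 0"
  shows "X = Y"
proof (rule poly_mapping_eqI)
  fix p show "Poly_Mapping.lookup X p = Poly_Mapping.lookup Y p"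
    using arg_cong[OF assms(1), of "\<lambda>Z. Poly_Mapping.lookup Z p"] assms(2) by simp
qed

lemma swap_conj:
  assumes "i \<noteq> j" "i \<noteq> k" "j \<noteq> k"
  shows "Perm.swap j k * Perm.swap i k = Perm.swap i j * Perm.swap j k"
  using assms by (intro perm_eqI) (auto simp: apply_times swap.rep_eq transpose_def)

lemma swap_disjoint:
  assumes "i \<noteq> k" "i \<noteq> l" "j \<noteq> k" "j \<noteq> l"
  shows "Perm.swap i j * Perm.swap k l = Perm.swap k l * Perm.swap i j"
  using assms by (intro perm_eqI) (auto simp: apply_times swap.rep_eq transpose_def)

lemma transp_commute: "transp i j = transp j i"
  by (simp add: transp_def swap_sym)

lemma transp_sq [simp]: "transp i j * transp i j = (1 :: 'k::comm_ring_1 group_algebra)"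
  by (simp add: transp_def mult_single plus_perm_def flip: zero_perm_def)

text \<open>
  Moving one transposition past another that shares a point relabels the latter.  The computations with columns
  use only this, \<open>transp_disjoint\<close> and \<open>transp_sq\<close>.
\<close>

lemma transp_conj:
  assumes "i \<noteq> j" "i \<noteq> k" "j \<noteq> k"
  shows "transp j k * transp i k = (transp i j * transp j k :: 'k::comm_ring_1 group_algebra)"
  using assms by (simp add: transp_def mult_single plus_perm_def swap_conj)

lemma transp_disjoint:
  assumes "i \<noteq> k" "i \<noteq> l" "j \<noteq> k" "j \<noteq> l"
  shows "transp i j * transp k l = (transp k l * transp i j :: 'k::comm_ring_1 group_algebra)"
  using assms by (simp add: transp_def mult_single plus_perm_def swap_disjoint)

lemma transp_scalar_commute:
  fixes Y :: "'k::comm_ring_1 group_algebra"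
  shows "transp i j * (scalar c * Y) = scalar c * (transp i j * Y)"
  by (rule scalar_left_commute)

text \<open>
  The idempotents live over the complex numbers, the evaluations over the field of rational functions.
  Identities are carried along by applying a homomorphism to all coefficients.
\<close>

locale coefficient_hom =
  fixes f :: "'k::comm_ring_1 \<Rightarrow> 'l::comm_ring_1"
  assumes hom_0 [simp]: "f 0 = 0" and hom_1 [simp]: "f 1 = 1"
    and hom_add: "f (a + b) = f a + f b"
    and hom_mult: "f (a * b) = f a * f b"
begin

abbreviation (input) ext :: "'k group_algebra \<Rightarrow> 'l group_algebra" where
  "ext \<equiv> Poly_Mapping.map f"

lemma lookup_ext: "Poly_Mapping.lookup (ext X) p = f (Poly_Mapping.lookup X p)"
  by (simp add: Poly_Mapping.map.rep_eq when_def)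

lemma hom_uminus: "f (- a) = - f a"
  by (metis add.right_inverse hom_0 hom_add minus_unique)

lemma hom_diff: "f (a - b) = f a - f b"
  using hom_add[of a "- b"] by (simp add: hom_uminus)

lemma hom_of_nat: "f (of_nat m) = of_nat m"
  by (induction m) (simp_all add: hom_add)

lemma hom_of_int: "f (of_int z) = of_int z"
  by (cases z) (simp_all add: hom_of_nat hom_uminus hom_diff)

lemma hom_prod: "f (\<Prod>i\<in>A. g i) = (\<Prod>i\<in>A. f (g i))"
  by (induction A rule: infinite_finite_induct) (simp_all add: hom_mult)

lemma ext_0 [simp]: "ext 0 = 0"
  by (rule poly_mapping_eqI) (simp add: lookup_ext)

lemma ext_add: "ext (X + Y) = ext X + ext Y"
  by (rule poly_mapping_eqI) (simp add: lookup_ext lookup_add hom_add)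

lemma ext_diff: "ext (X - Y) = ext X - ext Y"
  by (rule poly_mapping_eqI) (simp add: lookup_ext lookup_minus hom_diff)

lemma ext_single: "ext (Poly_Mapping.single p c) = Poly_Mapping.single p (f c)"
  by simp

lemma ext_scalar: "ext (scalar c) = scalar (f c)"
  by (simp add: scalar_def)

lemma ext_1 [simp]: "ext 1 = 1"
  using ext_scalar[of 1] by simp

lemma ext_transp: "ext (transp i j) = transp i j"
  by (simp add: transp_def)

lemma ext_sum: "ext (\<Sum>i\<in>A. X i) = (\<Sum>i\<in>A. ext (X i))"
  by (induction A rule: infinite_finite_induct) (simp_all add: ext_add)

lemma ext_mult: "ext (X * Y) = ext X * ext Y"
proof -
  have "ext (X * Y) = ext ((\<Sum>p\<in>Poly_Mapping.keys X. Poly_Mapping.single p (Poly_Mapping.lookup X p)) *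
       (\<Sum>p\<in>Poly_Mapping.keys Y. Poly_Mapping.single p (Poly_Mapping.lookup Y p)))"
    by (simp flip: sum_singles)
  also have "\<dots> = ext (\<Sum>p\<in>Poly_Mapping.keys X. Poly_Mapping.single p (Poly_Mapping.lookup X p)) *
       ext (\<Sum>p\<in>Poly_Mapping.keys Y. Poly_Mapping.single p (Poly_Mapping.lookup Y p))"
    unfolding sum_product ext_sum mult_single ext_single by (simp add: hom_mult)
  finally show ?thesis by (simp flip: sum_singles)
qed

lemma ext_prod_list: "ext (prod_list Xs) = prod_list (map ext Xs)"
  by (induction Xs) (simp_all add: ext_mult)

end

subsection \<open>The involution and positivity\<close>

text \<open>
  The conjugate-linear anti-involution that inverts permutations.  It is the adjoint for the inner product
  in which the permutations are orthonormal; hence the positivity below.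
\<close>

definition star :: "complex group_algebra \<Rightarrow> complex group_algebra" where
  "star X = (\<Sum>p\<in>Poly_Mapping.keys X. Poly_Mapping.single (- p) (cnj (Poly_Mapping.lookup X p)))"

lemma star_superset:
  assumes "finite A" "Poly_Mapping.keys X \<subseteq> A"
  shows "star X = (\<Sum>p\<in>A. Poly_Mapping.single (- p) (cnj (Poly_Mapping.lookup X p)))"
  unfolding star_def using assms
  by (intro sum.mono_neutral_left) (auto simp: in_keys_iff)

lemma star_0 [simp]: "star 0 = 0"
  by (simp add: star_def)

lemma star_single: "star (Poly_Mapping.single p c) = Poly_Mapping.single (- p) (cnj c)"
  by (subst star_superset[of "{p}"]) auto

lemma star_add: "star (X + Y) = star X + star Y"
proof -
  let ?A = "Poly_Mapping.keys X \<union> Poly_Mapping.keys Y"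
  have "finite ?A" "Poly_Mapping.keys (X + Y) \<subseteq> ?A"
    by (simp_all add: Poly_Mapping.keys_add)
  then show ?thesis
    by (subst (1 2 3) star_superset[of ?A])
       (auto simp: lookup_add single_add sum.distrib)
qed

lemma star_sum: "star (\<Sum>i\<in>A. X i) = (\<Sum>i\<in>A. star (X i))"
  by (induction A rule: infinite_finite_induct) (auto simp: star_add)

lemma star_mult: "star (X * Y) = star Y * star X"
proof -
  have "star (X * Y) = star ((\<Sum>p\<in>Poly_Mapping.keys X. Poly_Mapping.single p (Poly_Mapping.lookup X p)) *
       (\<Sum>p\<in>Poly_Mapping.keys Y. Poly_Mapping.single p (Poly_Mapping.lookup Y p)))"
    by (simp flip: sum_singles)
  also have "\<dots> = star (\<Sum>p\<in>Poly_Mapping.keys Y. Poly_Mapping.single p (Poly_Mapping.lookup Y p)) *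
       star (\<Sum>p\<in>Poly_Mapping.keys X. Poly_Mapping.single p (Poly_Mapping.lookup X p))"
    unfolding sum_product star_sum mult_single star_single
    by (subst sum.swap) (simp add: mult.commute minus_add)
  finally show ?thesis by (simp flip: sum_singles)
qed

lemma star_scalar: "star (scalar c) = scalar (cnj c)"
  by (simp add: scalar_def star_single)

lemma star_transp: "star (transp i j) = transp i j"
  by (simp add: transp_def star_single uminus_perm_def)

text \<open>
  The coefficient of the neutral element in \<open>X * star X\<close> is the sum of the \<open>\<bar>X\<^sub>p\<bar>\<^sup>2\<close>.
\<close>

lemma star_positive:
  assumes "Poly_Mapping.lookup (X * star X) 0 = 0"
  shows "X = 0"
proof -
  let ?K = "Poly_Mapping.keys X" and ?c = "Poly_Mapping.lookup X"
  have "X * star X = (\<Sum>p\<in>?K. \<Sum>q\<in>?K. Poly_Mapping.single (p - q) (?c p * cnj (?c q)))"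
    unfolding star_def
    by (subst (1) sum_singles[of X]) (simp add: sum_product mult_single)
  also have "Poly_Mapping.lookup \<dots> 0 =
      (\<Sum>p\<in>?K. \<Sum>q\<in>?K. if p = q then ?c p * cnj (?c q) else 0)"
    unfolding lookup_sum lookup_single when_def by (intro sum.cong refl) auto
  also have "\<dots> = (\<Sum>p\<in>?K. of_real ((cmod (?c p))\<^sup>2))"
    by (intro sum.cong refl) (simp only: sum.delta' finite_keys if_True complex_norm_square)
  also have "\<dots> = of_real (\<Sum>p\<in>?K. (cmod (?c p))\<^sup>2)" by simp
  finally have "(\<Sum>p\<in>?K. (cmod (?c p))\<^sup>2) = 0"
    using assms by (metis of_real_eq_0_iff)
  then have "\<forall>p\<in>?K. (cmod (?c p))\<^sup>2 = 0"
    by (subst (asm) sum_nonneg_eq_0_iff) auto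
  then have "Poly_Mapping.lookup X p = 0" for p
    by (cases "p \<in> ?K") (auto simp: in_keys_iff)
  then show ?thesis by (intro poly_mapping_eqI) simp
qed


section \<open>Products of transpositions moving a common point\<close>

text \<open>
  Only for \<open>k = m\<close> is this a Jucys--Murphy element.  The inductions below run over the truncated sums, for
  several points \<open>m\<close> at a time, and over arbitrary coefficients.
\<close>

definition jm :: "nat \<Rightarrow> nat \<Rightarrow> 'k::comm_ring_1 group_algebra" where
  "jm k m = (\<Sum>i\<in>{1..<k}. transp i m)"

lemma jm_Suc: "1 \<le> k \<Longrightarrow> jm (Suc k) m = jm k m + transp k m"
  by (simp add: jm_def)

lemma jm_0 [simp]: "jm 0 m = 0" and jm_1 [simp]: "jm (Suc 0) m = 0"
  by (simp_all add: jm_def)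

lemma jucys_murphy_eq_jm: "jucys_murphy r = jm r r"
  by (simp add: jucys_murphy_def jm_def)

lemma transp_prod_conj_right:
  assumes "\<And>i. i \<in> set xs \<Longrightarrow> i \<noteq> k \<and> i \<noteq> m" "k \<noteq> m"
  shows "transp k m * prod_list (map (\<lambda>i. 1 + scalar (c i) * transp i m) xs) =
    prod_list (map (\<lambda>i. 1 + scalar (c i) * transp i k) xs) *
      (transp k m :: 'k::comm_ring_1 group_algebra)"
  using assms(1)
proof (induction xs)
  case (Cons i xs)
  have "transp k m * (1 + scalar (c i) * transp i m) =
      (1 + scalar (c i) * transp i k) * (transp k m :: 'k group_algebra)"
    using Cons.prems[of i] assms(2) transp_conj[where ?'k = 'k, of i k m]
    by (simp add: ring_distribs transp_scalar_commute mult.assoc)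
  then have "transp k m * prod_list (map (\<lambda>i. 1 + scalar (c i) * transp i m) (i # xs)) =
      (1 + scalar (c i) * transp i k) *
        (transp k m * prod_list (map (\<lambda>i. 1 + scalar (c i) * transp i m) xs))"
    by (simp flip: mult.assoc)
  then show ?case using Cons by (simp add: mult.assoc)
qed simp

lemma transp_prod_conj_left:
  assumes "\<And>i. i \<in> set xs \<Longrightarrow> i \<noteq> k \<and> i \<noteq> m" "k \<noteq> m"
  shows "prod_list (map (\<lambda>i. 1 + scalar (c i) * transp i m) xs) * transp k m =
    transp k m * (prod_list (map (\<lambda>i. 1 + scalar (c i) * transp i k) xs)
      :: 'k::comm_ring_1 group_algebra)"
  using assms(1)
proof (induction xs)
  case (Cons i xs)
  have "transp i m * transp k m = transp k m * (transp i k :: 'k group_algebra)"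
    using Cons.prems[of i] assms(2) transp_conj[where ?'k = 'k, of k i m] transp_conj[where ?'k = 'k, of m k i]
    by (simp add: transp_commute[of k i] transp_commute[of m i] transp_commute[of m k])
  then have "(1 + scalar (c i) * transp i m) * transp k m =
      transp k m * (1 + scalar (c i) * transp i k :: 'k group_algebra)"
    by (simp add: ring_distribs transp_scalar_commute mult.assoc)
  then have "transp k m * prod_list (map (\<lambda>i. 1 + scalar (c i) * transp i k) (i # xs)) =
      (1 + scalar (c i) * transp i m) *
        (transp k m * (prod_list (map (\<lambda>i. 1 + scalar (c i) * transp i k) xs) :: 'k group_algebra))"
    by (simp flip: mult.assoc)
  then show ?case using Cons by (simp add: mult.assoc)
qed simp

text \<open>
  Induction on \<open>k\<close>.  The new leftmost factor contributes \<open>E s\<^sub>k\<^sub>m P(m)\<close>, where \<open>P(m)\<close> is the remaining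
  product.  Moving \<open>s\<^sub>k\<^sub>m\<close> to the right turns \<open>P(m)\<close> into \<open>P(k)\<close>; the induction hypothesis for \<open>m = k\<close> and
  \<open>E x\<^sub>k = w\<^sub>k E\<close> then give \<open>u E P(k) = (u - w\<^sub>k) E\<close>, which cancels the denominator.
\<close>

lemma weight_times_product:
  fixes E :: "'k::field group_algebra" and w :: "nat \<Rightarrow> 'k"
  assumes "\<And>i. 1 \<le> i \<Longrightarrow> i < k \<Longrightarrow> E * jm i i = scalar (w i) * E"
    and "\<And>i. 1 \<le> i \<Longrightarrow> i < k \<Longrightarrow> w i \<noteq> u"
    and "k \<le> m"
  shows "scalar u * (E * prod_list (map (\<lambda>i. 1 + scalar (1 / (w i - u)) * transp i m) (rev [1..<k])))
    = scalar u * E - E * jm k m"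
  using assms
proof (induction k arbitrary: m)
  case (Suc k)
  show ?case
  proof (cases "k = 0")
    case False
    let ?c = "\<lambda>i. 1 / (w i - u)"
    define P where "P = (\<lambda>m. prod_list (map (\<lambda>i. 1 + scalar (?c i) * transp i m) (rev [1..<k]))
      :: 'k group_algebra)"
    define t where "t = (transp k m :: 'k group_algebra)"
    define d where "d = ?c k"
    have IH: "scalar u * (E * P l) = scalar u * E - E * jm k l" if "k \<le> l" for l
      unfolding P_def using Suc that by simp
    have tP: "t * P m = P k * t"
      unfolding P_def t_def by (rule transp_prod_conj_right) (use Suc.prems in auto)
    have "E * ((1 + scalar d * t) * P m) = E * P m + scalar d * (E * P k) * t"
      by (simp add: ring_distribs mult.assoc tP scalar_left_commute[of E])
    then have "scalar u * (E * ((1 + scalar d * t) * P m)) =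
        scalar u * (E * P m) + scalar d * (scalar u * (E * P k)) * t"
      by (simp add: distrib_left mult.assoc scalar_left_commute[of "scalar u" d]
          scalar_left_commute[of t])
    also have "\<dots> = scalar u * E - E * jm k m
        + scalar d * (scalar u * E - scalar (w k) * E) * t"
      using IH[of m] IH[of k] Suc.prems(1)[of k] Suc.prems(3) False by simp
    also have "scalar d * (scalar u * E - scalar (w k) * E) = - E"
    proof -
      have "scalar d * (scalar u * E - scalar (w k) * E) = scalar (d * (u - w k)) * E"
        by (simp add: scalar_mult scalar_diff right_diff_distrib left_diff_distrib mult.assoc)
      also have "d * (u - w k) = - 1"
        using Suc.prems(2)[of k] False by (simp add: d_def field_simps)
      finally show ?thesis by (simp add: scalar_uminus)
    qed
    finally show ?thesis
      using False by (simp add: jm_Suc ring_distribs d_def t_def P_def)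
  qed simp
qed simp

text \<open>
  The mirror image of \<open>weight_times_product\<close>, with \<open>-u\<close> in place of \<open>u\<close>; the factors therefore occur in
  increasing order, which is the order in which they occur in \<open>\<Omega>\<close>.
\<close>

lemma product_times_weight:
  fixes E :: "'k::field group_algebra" and w :: "nat \<Rightarrow> 'k"
  assumes "\<And>i. 1 \<le> i \<Longrightarrow> i < k \<Longrightarrow> jm i i * E = scalar (w i) * E"
    and "\<And>i. 1 \<le> i \<Longrightarrow> i < k \<Longrightarrow> w i + u \<noteq> 0"
    and "k \<le> m"
  shows "scalar u * (prod_list (map (\<lambda>i. 1 + scalar (1 / (w i + u)) * transp i m) [1..<k]) * E)
    = scalar u * E + jm k m * E"
  using assms
proof (induction k arbitrary: m)
  case (Suc k)
  show ?case
  proof (cases "k = 0")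
    case False
    let ?c = "\<lambda>i. 1 / (w i + u)"
    define P where "P = (\<lambda>m. prod_list (map (\<lambda>i. 1 + scalar (?c i) * transp i m) [1..<k])
      :: 'k group_algebra)"
    define t where "t = (transp k m :: 'k group_algebra)"
    define d where "d = ?c k"
    have IH: "scalar u * (P l * E) = scalar u * E + jm k l * E" if "k \<le> l" for l
      unfolding P_def using Suc that by simp
    have tP: "P m * t = t * P k"
      unfolding P_def t_def by (rule transp_prod_conj_left) (use Suc.prems in auto)
    have "P m * (1 + scalar d * t) * E = P m * E + t * (scalar d * (P k * E))"
      by (simp add: ring_distribs scalar_left_commute[of "P m"] tP)
        (simp add: mult.assoc scalar_left_commute[of t])
    then have "scalar u * (P m * (1 + scalar d * t) * E) =
        scalar u * (P m * E) + t * (scalar d * (scalar u * (P k * E)))"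
      by (simp add: distrib_left mult.assoc scalar_left_commute[of "scalar u" d]
          scalar_left_commute[of t])
    also have "\<dots> = scalar u * E + jm k m * E
        + t * (scalar d * (scalar u * E + scalar (w k) * E))"
      using IH[of m] IH[of k] Suc.prems(1)[of k] Suc.prems(3) False by simp
    also have "scalar d * (scalar u * E + scalar (w k) * E) = E"
    proof -
      have "scalar d * (scalar u * E + scalar (w k) * E) = scalar (d * (w k + u)) * E"
        by (simp add: scalar_mult scalar_add distrib_left distrib_right mult.assoc)
      also have "d * (w k + u) = 1"
        using Suc.prems(2)[of k] False by (simp add: d_def)
      finally show ?thesis by simp
    qed
    finally show ?thesis
      using False by (simp add: jm_Suc ring_distribs d_def t_def P_def)
  qed simp
qed simp

text \<open>
  Pairs of factors \<open>1 + c s\<close> and \<open>1 - c s\<close> collapse to \<open>1 - c\<^sup>2\<close>, starting from the middle.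
\<close>

lemma reversed_product_inverse:
  fixes c :: "nat \<Rightarrow> 'k::comm_ring_1"
  shows "prod_list (map (\<lambda>i. 1 + scalar (c i) * transp i m) (rev xs)) *
    prod_list (map (\<lambda>i. 1 - scalar (c i) * transp i m) xs) =
    scalar (\<Prod>i\<leftarrow>xs. 1 - (c i)\<^sup>2)"
proof (induction xs)
  case (Cons i xs)
  let ?A = "prod_list (map (\<lambda>i. 1 + scalar (c i) * transp i m) (rev xs)) :: 'k group_algebra"
  let ?B = "prod_list (map (\<lambda>i. 1 - scalar (c i) * transp i m) xs) :: 'k group_algebra"
  have "(1 + scalar (c i) * transp i m) * (1 - scalar (c i) * transp i m) =
      (1 - scalar (c i) * scalar (c i) * (transp i m * transp i m) :: 'k group_algebra)"
    by (simp add: distrib_right right_diff_distrib mult.assoc transp_scalar_commute del: transp_sq)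
  also have "\<dots> = scalar (1 - (c i)\<^sup>2)"
    by (simp add: scalar_diff scalar_mult power2_eq_square)
  finally have sq: "(1 + scalar (c i) * transp i m) * (1 - scalar (c i) * transp i m) =
      (scalar (1 - (c i)\<^sup>2) :: 'k group_algebra)" .
  have *: "(1 + scalar (c i) * transp i m) * ((1 - scalar (c i) * transp i m) * ?B) =
      scalar (1 - (c i)\<^sup>2) * ?B"
    by (simp only: sq flip: mult.assoc)
  have "?A * ((1 + scalar (c i) * transp i m) * ((1 - scalar (c i) * transp i m) * ?B)) =
      scalar (1 - (c i)\<^sup>2) * (?A * ?B)"
    by (simp only: * scalar_left_commute[of ?A])
  then show ?case
    by (simp only: Cons scalar_mult rev.simps map_append list.map prod_list.append
        prod_list.Cons prod_list.Nil mult_1_right mult.assoc)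
qed simp

text \<open>
  The decreasing product of \<open>weight_times_product\<close> is, up to a scalar, inverse to the column.  Read as
  \<open>E R = f(u) E (u - x\<^sub>n)\<^sup>-\<^sup>1\<close>, the identity says that the column is a resolvent of \<open>x\<^sub>n = jm n n\<close>.
\<close>

lemma weight_times_column:
  fixes E :: "'k::field group_algebra" and w :: "nat \<Rightarrow> 'k"
  assumes "\<And>i. 1 \<le> i \<Longrightarrow> i < n \<Longrightarrow> E * jm i i = scalar (w i) * E"
    and "\<And>i. 1 \<le> i \<Longrightarrow> i < n \<Longrightarrow> w i \<noteq> u"
  shows "(scalar u * E - E * jm n n) *
      prod_list (map (\<lambda>i. 1 - scalar (1 / (w i - u)) * transp i n) [1..<n]) =
    scalar (u * (\<Prod>i\<in>{1..<n}. 1 - 1 / (u - w i)\<^sup>2)) * E"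
proof -
  let ?c = "\<lambda>i. 1 / (w i - u)"
  let ?A = "prod_list (map (\<lambda>i. 1 + scalar (?c i) * transp i n) (rev [1..<n]))"
  let ?B = "prod_list (map (\<lambda>i. 1 - scalar (?c i) * transp i n) [1..<n])"
  have "(scalar u * E - E * jm n n) * ?B = scalar u * (E * ?A) * ?B"
    by (subst weight_times_product) (use assms in auto)
  also have "\<dots> = scalar u * (E * (?A * ?B))"
    by (simp only: mult.assoc)
  also have "?A * ?B = scalar (\<Prod>i\<leftarrow>[1..<n]. 1 - (?c i)\<^sup>2)"
    by (rule reversed_product_inverse)
  also have "(\<Prod>i\<leftarrow>[1..<n]. 1 - (?c i)\<^sup>2) = (\<Prod>i\<in>{1..<n}. 1 - 1 / (u - w i)\<^sup>2)"
    by (subst prod.distinct_set_conv_list[symmetric])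
       (auto simp: power_one_over power2_commute)
  finally show ?thesis
    by (simp only: scalar_commute[of E] scalar_mult mult.assoc)
qed

subsection \<open>Commutation\<close>

text \<open>
  Conjugation by \<open>s\<^sub>i\<^sub>k\<close> permutes the summands of \<open>x\<^sub>n\<close>.
\<close>

lemma transp_commutes_jm:
  assumes "i < k" "k < n" "1 \<le> i"
  shows "transp i k * jm n n = (jm n n * transp i k :: 'k::comm_ring_1 group_algebra)"
proof -
  let ?t = "transp i k :: 'k group_algebra"
  have "?t * transp j n = transp (transpose i k j) n * ?t" if "j \<in> {1..<n}" for j
  proof -
    consider "j = i" | "j = k" | "j \<noteq> i" "j \<noteq> k" by blast
    then show ?thesis
    proof cases
      case 1
      then show ?thesis using assms transp_conj[where ?'k = 'k, of n k i]
        by (simp add: transp_commute[of k i] transp_commute[of n i] transp_commute[of n k])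
    next
      case 2
      then show ?thesis using assms transp_conj[where ?'k = 'k, of n i k]
        by (simp add: transp_commute[of n i] transp_commute[of n k])
    next
      case 3
      then show ?thesis using assms transp_disjoint[where ?'k = 'k, of i j n k] that by auto
    qed
  qed
  then have "?t * jm n n = (\<Sum>j\<in>{1..<n}. transp (transpose i k j) n) * ?t"
    by (simp add: jm_def sum_distrib_left sum_distrib_right)
  also have "(\<Sum>j\<in>{1..<n}. transp (transpose i k j) n) = (jm n n :: 'k group_algebra)"
    unfolding jm_def
    by (rule sum.reindex_bij_witness[of _ "transpose i k" "transpose i k"])
       (use assms in \<open>auto simp: transpose_def\<close>)
  finally show ?thesis .
qed

lemma jm_commute: "jm k k * jm n n = (jm n n * jm k k :: 'k::comm_ring_1 group_algebra)"
proof -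
  have *: "jm k k * jm n n = (jm n n * jm k k :: 'k group_algebra)" if "k < n" for k n
    unfolding jm_def[of k] sum_distrib_left sum_distrib_right
    by (intro sum.cong refl transp_commutes_jm) (use that in auto)
  show ?thesis using *[of k n] *[of n k] by (cases k n rule: linorder_cases) auto
qed


section \<open>Young diagrams\<close>

text \<open>
  Diagrams as finite sets closed under moving up and to the left.  This form is symmetric in rows and columns,
  and is easily checked after adding or removing a box.
\<close>

definition young :: "box set \<Rightarrow> bool" where
  "young D \<longleftrightarrow> finite D \<and> (\<forall>i j. (i, j) \<in> D \<longrightarrow> 1 \<le> i \<and> 1 \<le> j \<and>
     (\<forall>i' j'. 1 \<le> i' \<and> i' \<le> i \<and> 1 \<le> j' \<and> j' \<le> j \<longrightarrow> (i', j') \<in> D))"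

lemma young_finite: "young D \<Longrightarrow> finite D"
  unfolding young_def by (elim conjE)

lemma young_box:
  assumes "young D" "(i, j) \<in> D"
  shows "1 \<le> i \<and> 1 \<le> j \<and> (\<forall>i' j'. 1 \<le> i' \<and> i' \<le> i \<and> 1 \<le> j' \<and> j' \<le> j \<longrightarrow> (i', j') \<in> D)"
  using assms unfolding young_def by (elim conjE) (drule spec, drule spec, drule mp, assumption, assumption)

lemma young_pos: "young D \<Longrightarrow> (i, j) \<in> D \<Longrightarrow> 1 \<le> i \<and> 1 \<le> j"
  using young_box[of D i j] by simp

lemma young_down:
  assumes "young D" "(i, j) \<in> D" "1 \<le> i'" "i' \<le> i" "1 \<le> j'" "j' \<le> j"
  shows "(i', j') \<in> D"
  using young_box[OF assms(1,2)] assms(3-) by simp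

lemma youngI:
  assumes "finite D" "\<And>i j. (i, j) \<in> D \<Longrightarrow> 1 \<le> i \<and> 1 \<le> j"
    "\<And>i j i' j'. (i, j) \<in> D \<Longrightarrow> 1 \<le> i' \<Longrightarrow> i' \<le> i \<Longrightarrow> 1 \<le> j' \<Longrightarrow> j' \<le> j \<Longrightarrow> (i', j') \<in> D"
  shows "young D"
  unfolding young_def by (intro conjI allI impI assms(1)) (use assms(2,3) in blast)+

lemma initial_segment:
  fixes A :: "nat set"
  assumes "finite A" "\<And>a b. a \<in> A \<Longrightarrow> 1 \<le> a \<and> (1 \<le> b \<and> b \<le> a \<longrightarrow> b \<in> A)"
  shows "A = {1..card A}"
proof (cases "A = {}")
  case False
  have "A = {1..Max A}"
  proof (intro equalityI subsetI)
    show "a \<in> {1..Max A}" if "a \<in> A" for a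
      using assms(2)[OF that] Max_ge[OF assms(1) that] by simp
    show "a \<in> A" if "a \<in> {1..Max A}" for a
      using assms(2)[OF Max_in[OF assms(1) False], of a] that by simp
  qed
  then have "card A = Max A" by (metis card_atLeastAtMost diff_Suc_1)
  then show ?thesis using \<open>A = {1..Max A}\<close> by simp
qed simp

definition row :: "box set \<Rightarrow> nat \<Rightarrow> nat" where
  "row D i = card {j. (i, j) \<in> D}"

lemma finite_row: "young D \<Longrightarrow> finite {j. (i, j) \<in> D}"
  using finite_subset[of "{j. (i, j) \<in> D}" "snd ` D"] by (force simp: young_finite)

lemma young_iff_row:
  assumes "young D"
  shows "(i, j) \<in> D \<longleftrightarrow> 1 \<le> i \<and> 1 \<le> j \<and> j \<le> row D i"
proof -
  have "{j. (i, j) \<in> D} = {1..card {j. (i, j) \<in> D}}"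
    using assms young_pos[OF assms] young_down[OF assms]
    by (intro initial_segment finite_row) blast+
  then have "j \<in> {j. (i, j) \<in> D} \<longleftrightarrow> 1 \<le> j \<and> j \<le> row D i"
    unfolding row_def by (metis atLeastAtMost_iff)
  then show ?thesis using young_pos[OF assms] by auto
qed

lemma row_antimono:
  assumes "young D" "1 \<le> i" "i \<le> i'"
  shows "row D i' \<le> row D i"
proof (cases "row D i' = 0")
  case False
  then have "(i', row D i') \<in> D" using assms by (simp add: young_iff_row)
  then have "(i, row D i') \<in> D" using assms False by (auto intro: young_down)
  then show ?thesis using assms by (simp add: young_iff_row)
qed simp

definition rows :: "box set \<Rightarrow> nat" where
  "rows D = card {i. (i, 1) \<in> D}"

lemma le_rows_iff:
  assumes "young D" "1 \<le> i"
  shows "i \<le> rows D \<longleftrightarrow> 1 \<le> row D i"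
proof -
  have "finite {i. (i, 1) \<in> D}"
    using finite_subset[of "{i. (i, 1) \<in> D}" "fst ` D"] young_finite[OF assms(1)] by force
  then have "{i. (i, 1) \<in> D} = {1..card {i. (i, 1) \<in> D}}"
    using young_pos[OF assms(1)] young_down[OF assms(1), of _ 1 _ 1]
    by (intro initial_segment) auto
  then have "i \<in> {i. (i, 1) \<in> D} \<longleftrightarrow> i \<le> rows D"
    unfolding rows_def using assms(2) by (metis atLeastAtMost_iff)
  then show ?thesis using assms by (simp add: young_iff_row)
qed

lemma young_Sigma:
  assumes "young D"
  shows "D = Sigma {1..rows D} (\<lambda>i. {1..row D i})"
  using le_rows_iff[OF assms] young_iff_row[OF assms] by (auto simp: Suc_le_eq)

lemma young_diagram: "is_partition lam \<Longrightarrow> young (diagram lam)"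
proof -
  assume *: "is_partition lam"
  have "diagram lam \<subseteq> {0..length lam} \<times> {0..sum_list lam}"
    by (auto simp: diagram_def intro!: order_trans[OF _ elem_le_sum_list])
  then have "finite (diagram lam)" by (rule finite_subset) simp
  moreover have "lam ! (i - 1) \<le> lam ! (i' - 1)" if "1 \<le> i'" "i' \<le> i" "i \<le> length lam" for i i'
    using * that by (cases "i = i'") (auto simp: is_partition_def sorted_wrt_iff_nth_less)
  ultimately show ?thesis
    by (intro youngI) (auto simp: diagram_def intro: order_trans)
qed

lemma is_diagram_iff_young: "is_diagram D \<longleftrightarrow> young D"
proof
  assume D: "young D"
  define lam where "lam = map (row D) [1..<Suc (rows D)]"
  have "\<forall>i\<in>{1..<Suc (rows D)}. 0 \<noteq> row D i"
  proof
    fix i assume "i \<in> {1..<Suc (rows D)}"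
    then show "0 \<noteq> row D i" using le_rows_iff[OF D, of i] by auto
  qed
  then have "is_partition lam"
    using row_antimono[OF D]
    by (auto simp: is_partition_def lam_def sorted_wrt_iff_nth_less simp del: upt_Suc)
  moreover have "D = diagram lam"
  proof -
    have nth: "lam ! (i - 1) = row D i" if "1 \<le> i" "i \<le> rows D" for i
      using that by (simp add: lam_def del: upt_Suc)
    have len: "length lam = rows D" by (simp add: lam_def)
    have "(i, j) \<in> D \<longleftrightarrow> (i, j) \<in> diagram lam" for i j
      using le_rows_iff[OF D, of i] nth[of i] by (auto simp: diagram_def young_iff_row[OF D] len)
    then show ?thesis by auto
  qed
  ultimately show "is_diagram D" unfolding is_diagram_def by blast
qed (auto simp: is_diagram_def young_diagram)

subsection \<open>Addable boxes\<close>

lemma addable_iff_young: "b \<in> addable D \<longleftrightarrow> b \<notin> D \<and> young (insert b D)"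
  by (simp add: addable_def is_diagram_iff_young)

lemma addable_iff_row:
  assumes "young D"
  shows "(i, j) \<in> addable D \<longleftrightarrow> 1 \<le> i \<and> j = row D i + 1 \<and> (i = 1 \<or> row D i < row D (i - 1))"
proof
  assume "(i, j) \<in> addable D"
  then have *: "(i, j) \<notin> D" "young (insert (i, j) D)" by (auto simp: addable_iff_young)
  have pos: "1 \<le> i" "1 \<le> j" using young_pos[OF *(2), of i j] by auto
  have "row D i < j" using *(1) pos assms by (auto simp: young_iff_row)
  moreover have "(i, j - 1) \<in> D" if "j \<noteq> 1"
  proof -
    have "1 \<le> j - 1" "j - 1 \<noteq> j" using that pos by auto
    then show ?thesis using young_down[OF *(2), of i j i "j - 1"] pos by auto
  qed
  then have "j - 1 \<le> row D i" using assms pos by (cases "j = 1") (auto simp: young_iff_row)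
  ultimately have j: "j = row D i + 1" using pos by simp
  have "row D i < row D (i - 1)" if "i \<noteq> 1"
  proof -
    have "1 \<le> i - 1" "i - 1 \<noteq> i" using that pos by auto
    then show ?thesis
      using young_down[OF *(2), of i j "i - 1" j] pos j by (auto simp: young_iff_row[OF assms])
  qed
  then show "1 \<le> i \<and> j = row D i + 1 \<and> (i = 1 \<or> row D i < row D (i - 1))"
    using pos j by blast
next
  assume *: "1 \<le> i \<and> j = row D i + 1 \<and> (i = 1 \<or> row D i < row D (i - 1))"
  have "(i', j') \<in> insert (i, j) D" if "1 \<le> i'" "i' \<le> i" "1 \<le> j'" "j' \<le> j" for i' j'
  proof (cases "i' = i")
    case False
    then have "row D (i - 1) \<le> row D i'" using row_antimono[OF assms, of i' "i - 1"] that by auto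
    then show ?thesis using * that False by (auto simp: young_iff_row[OF assms])
  qed (use * that in \<open>auto simp: young_iff_row[OF assms]\<close>)
  note corner = this
  have "young (insert (i, j) D)"
  proof (rule youngI)
    show "finite (insert (i, j) D)" using young_finite[OF assms] by simp
    show "1 \<le> a \<and> 1 \<le> b" if "(a, b) \<in> insert (i, j) D" for a b
      using that * young_pos[OF assms, of a b] by auto
    show "(i', j') \<in> insert (i, j) D"
      if "(a, b) \<in> insert (i, j) D" "1 \<le> i'" "i' \<le> a" "1 \<le> j'" "j' \<le> b" for a b i' j'
      using that corner[of i' j'] young_down[OF assms, of a b i' j'] by auto
  qed
  then show "(i, j) \<in> addable D"
    using * by (auto simp: addable_iff_young young_iff_row[OF assms])
qed

definition addable_rows :: "box set \<Rightarrow> nat set" where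
  "addable_rows D = {i \<in> {1..Suc (rows D)}. i = 1 \<or> row D i < row D (i - 1)}"

lemma row_eq_0: "young D \<Longrightarrow> rows D < i \<Longrightarrow> row D i = 0"
  using le_rows_iff[of D i] by fastforce

lemma addable_image:
  assumes "young D"
  shows "addable D = (\<lambda>i. (i, row D i + 1)) ` addable_rows D"
proof -
  have "i \<le> Suc (rows D)" if "row D i < row D (i - 1)" for i
  proof (rule ccontr)
    assume "\<not> i \<le> Suc (rows D)"
    then have "rows D < i - 1" by simp
    then show False using that row_eq_0[OF assms, of "i - 1"] by simp
  qed
  then show ?thesis
    unfolding addable_rows_def using addable_iff_row[OF assms] by (auto simp: image_iff)
qed

lemma finite_addable: "young D \<Longrightarrow> finite (addable D)"
  by (simp add: addable_image addable_rows_def)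

text \<open>
  The contents of the boxes just after the ends of the rows decrease strictly from row to row.
\<close>

lemma content_row_end_inj:
  assumes "young D"
  shows "inj_on (\<lambda>i. content (i, row D i + 1)) {1..}"
proof (rule linorder_inj_onI)
  fix i i' :: nat assume "i < i'" "i \<in> {1..}"
  then have "row D i' \<le> row D i" using assms by (intro row_antimono) auto
  then show "content (i, row D i + 1) \<noteq> content (i', row D i' + 1)"
    using \<open>i < i'\<close> by simp
qed auto

lemma content_inj_addable:
  assumes "young D"
  shows "inj_on content (addable D)"
proof -
  have "inj_on (\<lambda>i. content (i, row D i + 1)) (addable_rows D)"
    by (rule inj_on_subset[OF content_row_end_inj[OF assms]]) (auto simp: addable_rows_def)
  then show ?thesis
    unfolding addable_image[OF assms] by (auto simp: inj_on_def)
qed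

subsection \<open>The content function of a diagram\<close>

text \<open>
  All contents are integers, so this guarantees that nothing in sight has a pole or a zero at \<open>u\<close>.
\<close>

definition not_int :: "'k::field_char_0 \<Rightarrow> bool" where
  "not_int u \<longleftrightarrow> (\<forall>z. u \<noteq> of_int z)"

text \<open>
  \<open>u * gap_prod D u\<close> is the function \<open>f(u)\<close> of \<open>weight_times_column\<close> when the weights are the contents
  of the boxes of \<open>D\<close>.
\<close>

definition gap_prod :: "box set \<Rightarrow> 'k::field_char_0 \<Rightarrow> 'k" where
  "gap_prod D u = (\<Prod>b\<in>D. 1 - 1 / (u - of_int (content b))\<^sup>2)"

lemma not_int_diff: "not_int u \<Longrightarrow> u - of_int z \<noteq> 0"
  by (simp add: not_int_def)

lemma not_int_add: "not_int u \<Longrightarrow> not_int (u + of_int z)"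
  unfolding not_int_def by (metis add_diff_cancel_right' of_int_diff)

lemma not_int_add_nat: "not_int u \<Longrightarrow> not_int (u + of_nat z)"
  using not_int_add[of u "int z"] by simp

lemma not_int_diff_nat: "not_int u \<Longrightarrow> u - of_nat m \<noteq> 0"
  using not_int_diff[of u "int m"] by simp

text \<open>
  With \<open>y\<^sub>j = w - j\<close> the factor is \<open>y\<^sub>j\<^sub>+\<^sub>1 y\<^sub>j\<^sub>-\<^sub>1 / y\<^sub>j\<^sup>2\<close>, so that two telescoping products arise.  The hypothesis
  is weak enough for integral \<open>w\<close> outside the range, which occurs in \<open>gap_prod_right_part\<close>.
\<close>

lemma telescope_gap:
  fixes w :: "'k::field_char_0"
  assumes "\<And>j. j \<le> max 1 m \<Longrightarrow> w \<noteq> of_nat j"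
  shows "(\<Prod>j=1..m. 1 - 1 / (w - of_nat j)\<^sup>2) =
    ((w - of_nat m - 1) * w) / ((w - 1) * (w - of_nat m))"
  using assms
proof (induction m)
  case 0
  then show ?case using 0[of 0] 0[of 1] by simp
next
  case (Suc m)
  have "w - of_nat (Suc m) \<noteq> 0" "w - of_nat m \<noteq> 0" "w - 1 \<noteq> 0"
    using Suc.prems[of "Suc m"] Suc.prems[of m] Suc.prems[of 1] by auto
  then have nz: "w - 1 - of_nat m \<noteq> 0" "w - of_nat m \<noteq> 0" "w - 1 \<noteq> 0"
    by (simp_all add: algebra_simps)
  have IH: "(\<Prod>j=1..m. 1 - 1 / (w - of_nat j)\<^sup>2) =
    ((w - of_nat m - 1) * w) / ((w - 1) * (w - of_nat m))"
    using Suc.prems by (intro Suc.IH) auto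
  define x where "x = w - of_nat m"
  have x: "x \<noteq> 0" "x - 1 \<noteq> 0" using nz by (auto simp: x_def algebra_simps)
  have "(\<Prod>j=1..Suc m. 1 - 1 / (w - of_nat j)\<^sup>2) =
      ((x - 1) * w) / ((w - 1) * x) * (1 - 1 / (x - 1)\<^sup>2)"
    using IH by (simp add: x_def algebra_simps)
  also have "\<dots> = ((x - 2) * w) / ((w - 1) * (x - 1))"
    using x nz by (simp add: divide_simps) (simp add: algebra_simps power2_eq_square)
  finally show ?case by (simp add: x_def algebra_simps)
qed

lemma telescope_ratio:
  fixes g :: "nat \<Rightarrow> 'k::field"
  assumes "\<And>i. i \<le> m \<Longrightarrow> g i \<noteq> 0"
  shows "(\<Prod>i=1..m. g i / g (i - 1)) = g m / g 0"
  using assms by (induction m) auto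

text \<open>
  Each row telescopes by \<open>telescope_gap\<close>; what remains besides the two ends of the rows telescopes over the
  rows and yields the content of the box below the first column.
\<close>

lemma content_function_rows:
  fixes u :: "'k::field_char_0"
  assumes "young D" "not_int u"
  shows "u * gap_prod D u = (\<Prod>i=1..Suc (rows D). u - of_int (content (i, row D i + 1))) /
    (\<Prod>i=1..rows D. u - of_int (content (i, row D i)))"
proof -
  let ?l = "rows D"
  have "gap_prod D u = (\<Prod>i=1..?l. \<Prod>j=1..row D i. 1 - 1 / (u - of_int (content (i, j)))\<^sup>2)"
    unfolding gap_prod_def by (subst young_Sigma[OF assms(1)], subst prod.Sigma)
      (auto intro!: prod.cong simp del: content.simps)
  also have "\<dots> = (\<Prod>i=1..?l. (u - of_int (content (i, row D i + 1))) / (u - of_int (content (i, row D i)))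
      * ((u + of_nat i) / (u + of_nat (i - 1))))"
  proof (intro prod.cong refl)
    fix i assume i: "i \<in> {1..?l}"
    have "(\<Prod>j=1..row D i. 1 - 1 / (u - of_int (content (i, j)))\<^sup>2) =
        (\<Prod>j=1..row D i. 1 - 1 / ((u + of_nat i) - of_nat j)\<^sup>2)"
      by (simp add: algebra_simps)
    also have "\<dots> = ((u + of_nat i) - of_nat (row D i) - 1) * (u + of_nat i) /
        (((u + of_nat i) - 1) * ((u + of_nat i) - of_nat (row D i)))"
      using not_int_diff_nat[OF not_int_add_nat[OF assms(2)], of i]
      by (intro telescope_gap) auto
    also have "\<dots> = (u - of_int (content (i, row D i + 1))) / (u - of_int (content (i, row D i)))
      * ((u + of_nat i) / (u + of_nat (i - 1)))"
      using i by (simp add: of_nat_diff algebra_simps)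
    finally show "(\<Prod>j=1..row D i. 1 - 1 / (u - of_int (content (i, j)))\<^sup>2) = \<dots>" .
  qed
  also have "\<dots> = (\<Prod>i=1..?l. u - of_int (content (i, row D i + 1))) /
     (\<Prod>i=1..?l. u - of_int (content (i, row D i))) * ((u + of_nat ?l) / u)"
  proof -
    have "(\<Prod>i=1..?l. (u + of_nat i) / (u + of_nat (i - 1))) = (u + of_nat ?l) / (u + of_nat 0)"
      using not_int_diff[OF not_int_add_nat[OF assms(2)], of _ 0] by (intro telescope_ratio) simp
    then show ?thesis by (simp only: prod.distrib prod_dividef of_nat_0 add_0_right)
  qed
  finally have *: "gap_prod D u = \<dots>" .
  have "row D (Suc ?l) = 0" using assms by (simp add: row_eq_0)
  then have "u - of_int (content (Suc ?l, row D (Suc ?l) + 1)) = u + of_nat ?l" by simp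
  moreover have "u * (N / M * (x / u)) = N * x / M" for N M x :: 'k
    using not_int_diff[OF assms(2), of 0] by simp
  ultimately show ?thesis
    unfolding * by (simp del: content.simps)
qed

text \<open>
  In \<open>content_function_rows\<close>, a row that is not addable is as long as the row above it, so that its factor
  in the numerator cancels a factor in the denominator.  The factors left in the denominator make up \<open>h\<close>;
  its zeros are the contents of the removable boxes.
\<close>

lemma content_function_addable:
  assumes "young D"
  shows "\<exists>h :: 'k::field_char_0 poly. \<forall>u. not_int u \<longrightarrow>
    u * gap_prod D u * poly h u = (\<Prod>a\<in>content ` addable D. u - of_int a)"
proof -
  let ?l = "rows D"
  let ?A = "\<lambda>i. content (i, row D i + 1)" and ?R = "\<lambda>i. content (i, row D i)"
  let ?S = "{2..Suc ?l}"
  define h :: "'k poly" where "h = (\<Prod>i\<in>?S \<inter> addable_rows D. [:- of_int (?R (i - 1)), 1:])"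
  have "u * gap_prod D u * poly h u = (\<Prod>a\<in>content ` addable D. u - of_int a)"
    if u: "not_int u" for u :: 'k
  proof -
    have "(\<Prod>i=1..Suc ?l. u - of_int (?A i)) =
        (\<Prod>i\<in>addable_rows D. u - of_int (?A i)) * (\<Prod>i\<in>?S - addable_rows D. u - of_int (?A i))"
    proof -
      have S: "{1..Suc ?l} = addable_rows D \<union> (?S - addable_rows D)"
        by (auto simp: addable_rows_def)
      show ?thesis
        by (subst S, subst prod.union_disjoint) (auto simp: addable_rows_def)
    qed
    moreover have "(\<Prod>i\<in>?S - addable_rows D. u - of_int (?A i)) =
        (\<Prod>i\<in>?S - addable_rows D. u - of_int (?R (i - 1)))"
    proof (intro prod.cong refl)
      fix i assume i: "i \<in> ?S - addable_rows D"
      then have "row D i = row D (i - 1)"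
        using row_antimono[OF assms, of "i - 1" i] by (auto simp: addable_rows_def)
      then have "?A i = ?R (i - 1)" using i by (auto simp: of_nat_diff)
      then show "u - of_int (?A i) = u - of_int (?R (i - 1))" by simp
    qed
    moreover have ph: "poly h u = (\<Prod>i\<in>?S \<inter> addable_rows D. u - of_int (?R (i - 1)))"
      by (simp add: h_def poly_prod del: content.simps)
    ultimately have num: "(\<Prod>i=1..Suc ?l. u - of_int (?A i)) * poly h u =
        (\<Prod>i\<in>addable_rows D. u - of_int (?A i)) * ((\<Prod>i\<in>?S - addable_rows D. u - of_int (?R (i - 1)))
          * (\<Prod>i\<in>?S \<inter> addable_rows D. u - of_int (?R (i - 1))))"
      by (simp add: ph del: content.simps)
    have "(\<Prod>i\<in>?S - addable_rows D. u - of_int (?R (i - 1)))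
          * (\<Prod>i\<in>?S \<inter> addable_rows D. u - of_int (?R (i - 1))) = (\<Prod>i\<in>?S. u - of_int (?R (i - 1)))"
      by (subst prod.union_disjoint[symmetric]) (auto simp: Un_Diff_Int simp del: content.simps)
    also have "\<dots> = (\<Prod>i=1..?l. u - of_int (?R i))"
      by (rule prod.reindex_bij_witness[of _ Suc "\<lambda>i. i - 1"]) auto
    finally have "(\<Prod>i=1..Suc ?l. u - of_int (?A i)) * poly h u =
        (\<Prod>i\<in>addable_rows D. u - of_int (?A i)) * (\<Prod>i=1..?l. u - of_int (?R i))"
      unfolding num by simp
    moreover have "(\<Prod>i=1..?l. u - of_int (?R i)) \<noteq> 0"
      using not_int_diff[OF u] by (simp del: content.simps)
    ultimately have "u * gap_prod D u * poly h u = (\<Prod>i\<in>addable_rows D. u - of_int (?A i))"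
      unfolding content_function_rows[OF assms u] by (simp add: field_simps del: content.simps)
    also have "\<dots> = (\<Prod>a\<in>?A ` addable_rows D. u - of_int a)"
    proof -
      have "inj_on ?A (addable_rows D)"
        by (rule inj_on_subset[OF content_row_end_inj[OF assms]]) (auto simp: addable_rows_def)
      then show ?thesis by (simp only: prod.reindex o_def)
    qed
    also have "?A ` addable_rows D = content ` addable D"
      by (simp add: addable_image[OF assms] image_image del: content.simps)
    finally show ?thesis .
  qed
  then show ?thesis by blast
qed


subsection \<open>Transposed diagrams\<close>

definition flip :: "box set \<Rightarrow> box set" where
  "flip D = prod.swap ` D"

lemma flip_iff [simp]: "(i, j) \<in> flip D \<longleftrightarrow> (j, i) \<in> D"
  unfolding flip_def by force

lemma flip_insert: "flip (insert (i, j) D) = insert (j, i) (flip D)"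
  by (simp add: flip_def)

lemma young_flip:
  assumes "young D"
  shows "young (flip D)"
proof (rule youngI)
  show "finite (flip D)" using young_finite[OF assms] by (simp add: flip_def)
  show "1 \<le> i \<and> 1 \<le> j" if "(i, j) \<in> flip D" for i j
    using that young_pos[OF assms, of j i] by simp
  show "(i', j') \<in> flip D"
    if "(i, j) \<in> flip D" "1 \<le> i'" "i' \<le> i" "1 \<le> j'" "j' \<le> j" for i j i' j'
    using that young_down[OF assms, of j i j' i'] by simp
qed

lemma addable_flip: "(i, j) \<in> addable D \<Longrightarrow> (j, i) \<in> addable (flip D)"
  using young_flip[of "insert (i, j) D"] by (auto simp: addable_iff_young flip_insert)

lemma gap_prod_flip:
  assumes "A = flip B"
  shows "gap_prod A (- u) = gap_prod B u"
proof -
  have "content (prod.swap b) = - content b" for b by (cases b) simp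
  moreover have "(- u - - x)\<^sup>2 = (u - x)\<^sup>2" for x
    by (simp add: power2_eq_square algebra_simps)
  ultimately show ?thesis
    unfolding gap_prod_def assms flip_def by (subst prod.reindex) simp_all
qed

lemma hook_length_flip: "hook_length (flip D) (j, i) = hook_length D (i, j)"
proof -
  have "{(i', j') \<in> flip D. (i' = j \<and> i \<le> j') \<or> (j' = i \<and> j \<le> i')} =
      prod.swap ` {(i', j') \<in> D. (i' = i \<and> j \<le> j') \<or> (j' = j \<and> i \<le> i')}"
    by (force simp: flip_def)
  then show ?thesis by (simp add: card_image)
qed

subsection \<open>Adding a box: the change of the hook product\<close>

text \<open>
  The passage from a diagram \<open>\<mu> = D\<close> to \<open>\<lambda> = insert (p, q) D\<close>.  The boxes of \<open>D\<close> outside the rectangle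
  spanned by \<open>(p, q)\<close> lie either strictly to the right or strictly below.
\<close>

locale added_box =
  fixes D :: "box set" and p q :: nat
  assumes young: "young D" and box: "(p, q) \<in> addable D"
begin

lemma p_pos: "1 \<le> p" and q_pos: "1 \<le> q" and notin: "(p, q) \<notin> D"
  using box young_pos[of "insert (p, q) D" p q] by (auto simp: addable_iff_young)

lemma young_insert: "young (insert (p, q) D)"
  using box by (simp add: addable_iff_young)

lemma above: "1 \<le> i \<Longrightarrow> i < p \<Longrightarrow> 1 \<le> j \<Longrightarrow> j \<le> q \<Longrightarrow> (i, j) \<in> D"
  using young_down[OF young_insert, of p q i j] by auto

lemma left: "1 \<le> i \<Longrightarrow> i \<le> p \<Longrightarrow> 1 \<le> j \<Longrightarrow> j < q \<Longrightarrow> (i, j) \<in> D"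
  using young_down[OF young_insert, of p q i j] by auto

lemma outside: "p \<le> i \<Longrightarrow> q \<le> j \<Longrightarrow> (i, j) \<notin> D"
  using young_down[OF young, of i j p q] p_pos q_pos notin by auto

lemma flipped: "added_box (flip D) q p"
  using young_flip[OF young] addable_flip[OF box] by unfold_locales

definition right_part :: "box set" where "right_part = {(i, j) \<in> D. q < j}"
definition lower_part :: "box set" where "lower_part = {(i, j) \<in> D. p < i}"

text \<open>
  The arm has \<open>row D i - q\<close> boxes, and the leg ends just above the new box.
\<close>

lemma hook_length_above:
  assumes "1 \<le> i" "i < p"
  shows "hook_length D (i, q) = (row D i - q) + (p - i)"
proof -
  have q: "q \<le> row D i" using above[OF assms q_pos] young_iff_row[OF young] by auto
  have "{(i', j') \<in> D. (i' = i \<and> q \<le> j') \<or> (j' = q \<and> i \<le> i')} =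
      {i} \<times> {q..row D i} \<union> {Suc i..<p} \<times> {q}"
  proof (intro set_eqI iffI)
    fix b assume "b \<in> {(i', j') \<in> D. (i' = i \<and> q \<le> j') \<or> (j' = q \<and> i \<le> i')}"
    moreover obtain a a' where "b = (a, a')" by (cases b)
    ultimately show "b \<in> {i} \<times> {q..row D i} \<union> {Suc i..<p} \<times> {q}"
      using outside[of a q] young_iff_row[OF young] 
      by (cases "a = i"; cases "p \<le> a") (auto simp: not_le)
  next
    fix b assume "b \<in> {i} \<times> {q..row D i} \<union> {Suc i..<p} \<times> {q}"
    then show "b \<in> {(i', j') \<in> D. (i' = i \<and> q \<le> j') \<or> (j' = q \<and> i \<le> i')}"
      using above[of _ q] assms q_pos young_iff_row[OF young] by auto
  qed
  then have "hook_length D (i, q) = card ({i} \<times> {q..row D i} \<union> {Suc i..<p} \<times> {q})" by simp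
  also have "\<dots> = card ({i} \<times> {q..row D i}) + card ({Suc i..<p} \<times> {q})"
    by (rule card_Un_disjoint) auto
  finally show ?thesis using q assms by (simp add: card_cartesian_product)
qed

text \<open>
  Row \<open>i\<close> of \<open>right_part\<close> telescopes to \<open>(h + 1) / h\<close>, \<open>h\<close> being the hook length above the new box, times
  \<open>d / (d + 1)\<close> with \<open>d = p - i\<close>.  The latter factors multiply up to \<open>1 / p\<close>.
\<close>

lemma gap_prod_right_part:
  "of_nat p * gap_prod right_part (of_int (content (p, q))) =
    (\<Prod>i\<in>{1..<p}. (of_nat (hook_length D (i, q)) + 1) / of_nat (hook_length D (i, q)) :: 'k::field_char_0)"
proof -
  let ?c = "of_int (content (p, q)) :: 'k"
  have right_part: "right_part = Sigma {1..<p} (\<lambda>i. {Suc q..row D i})"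
    using outside young_iff_row[OF young] by (fastforce simp: right_part_def not_le[symmetric])
  have "gap_prod right_part ?c = (\<Prod>i\<in>{1..<p}. \<Prod>j\<in>{Suc q..row D i}. 1 - 1 / (?c - of_int (content (i, j)))\<^sup>2)"
    unfolding gap_prod_def right_part by (subst prod.Sigma) (auto intro!: prod.cong simp del: content.simps)
  also have "\<dots> = (\<Prod>i\<in>{1..<p}. (of_nat (hook_length D (i, q)) + 1) / of_nat (hook_length D (i, q)) *
      (of_nat (p - i) / (of_nat (p - i) + 1)))"
  proof (intro prod.cong refl)
    fix i assume i: "i \<in> {1..<p}"
    let ?m = "row D i - q" and ?d = "of_nat (p - i) :: 'k"
    have q: "q \<le> row D i" using above[of i q] i q_pos young_iff_row[OF young] by auto
    have d: "?d = of_nat p - of_nat i" using i by (simp add: of_nat_diff)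
    have "(\<Prod>j\<in>{Suc q..row D i}. 1 - 1 / (?c - of_int (content (i, j)))\<^sup>2) =
        (\<Prod>t=1..?m. 1 - 1 / (- ?d - of_nat t)\<^sup>2)"
      by (rule prod.reindex_bij_witness[of _ "\<lambda>t. q + t" "\<lambda>j. j - q"])
        (use q in \<open>auto simp: d of_nat_diff algebra_simps\<close>)
    also have "\<dots> = ((- ?d - of_nat ?m - 1) * - ?d) / ((- ?d - 1) * (- ?d - of_nat ?m))"
    proof (rule telescope_gap)
      fix j
      have "?d + of_nat j = of_nat (p - i + j)" by simp
      also have "\<dots> \<noteq> 0" using i by (simp del: of_nat_add)
      finally show "- ?d \<noteq> of_nat j" by (metis add.right_inverse)
    qed
    also have "\<dots> = (of_nat (hook_length D (i, q)) + 1) / of_nat (hook_length D (i, q)) *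
      (?d / (?d + 1))"
    proof -
      have h: "of_nat (hook_length D (i, q)) = of_nat ?m + ?d"
        using i by (subst hook_length_above) auto
      have "(- d - m - 1) * - d = (m + d + 1) * d" "(- d - 1) * (- d - m) = (m + d) * (d + 1)"
        for d m :: 'k by (simp_all add: algebra_simps)
      then show ?thesis unfolding h by (simp only: times_divide_times_eq)
    qed
    finally show "(\<Prod>j\<in>{Suc q..row D i}. 1 - 1 / (?c - of_int (content (i, j)))\<^sup>2) = \<dots>" .
  qed
  also have "\<dots> = (\<Prod>i\<in>{1..<p}. (of_nat (hook_length D (i, q)) + 1) / of_nat (hook_length D (i, q))) *
      (\<Prod>i\<in>{1..<p}. of_nat (p - i) / (of_nat (p - i) + 1))"
    by (rule prod.distrib)
  also have "(\<Prod>i\<in>{1..<p}. of_nat (p - i) / (of_nat (p - i) + 1)) =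
      (\<Prod>i\<in>{1..<p}. of_nat i / (of_nat i + 1) :: 'k)"
    by (rule prod.reindex_bij_witness[of _ "\<lambda>i. p - i" "\<lambda>i. p - i"]) auto
  also have "\<dots> = 1 / of_nat p"
    using p_pos
  proof (induction p rule: dec_induct)
    case (step m)
    have "(of_nat m + 1 :: 'k) \<noteq> 0" by (metis of_nat_Suc of_nat_neq_0 add.commute)
    then show ?case using step by (simp add: add.commute)
  qed simp
  finally show ?thesis using p_pos by simp
qed

lemma hook_length_insert:
  "hook_length (insert (p, q) D) (i, j) =
    (if (p = i \<and> j \<le> q) \<or> (q = j \<and> i \<le> p) then Suc (hook_length D (i, j)) else hook_length D (i, j))"
proof -
  have "finite {(i', j') \<in> D. (i' = i \<and> j \<le> j') \<or> (j' = j \<and> i \<le> i')}"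
    using young_finite[OF young] by (rule rev_finite_subset) auto
  moreover have "{(i', j') \<in> insert (p, q) D. (i' = i \<and> j \<le> j') \<or> (j' = j \<and> i \<le> i')} =
    (if (p = i \<and> j \<le> q) \<or> (q = j \<and> i \<le> p)
     then insert (p, q) {(i', j') \<in> D. (i' = i \<and> j \<le> j') \<or> (j' = j \<and> i \<le> i')}
     else {(i', j') \<in> D. (i' = i \<and> j \<le> j') \<or> (j' = j \<and> i \<le> i')})" by auto
  ultimately show ?thesis using notin by simp
qed

lemma hook_length_pos:
  assumes "b \<in> D" shows "hook_length D b \<noteq> 0"
proof -
  obtain i j where b: "b = (i, j)" by (cases b)
  have "finite {(i', j') \<in> D. (i' = i \<and> j \<le> j') \<or> (j' = j \<and> i \<le> i')}"
    using young_finite[OF young] by (rule rev_finite_subset) auto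
  then show ?thesis using assms b by auto
qed

text \<open>
  Adding the box lengthens by one exactly the hooks of the boxes above it and to its left.
\<close>

lemma hook_product_insert:
  "of_nat (hook_product (insert (p, q) D)) = (of_nat (hook_product D) :: 'k::field_char_0) *
    ((\<Prod>i\<in>{1..<p}. (of_nat (hook_length D (i, q)) + 1) / of_nat (hook_length D (i, q))) *
     (\<Prod>j\<in>{1..<q}. (of_nat (hook_length D (p, j)) + 1) / of_nat (hook_length D (p, j))))"
proof -
  let ?r = "\<lambda>b. (of_nat (hook_length D b) + 1) / of_nat (hook_length D b) :: 'k"
  define C where "C = (\<lambda>i. (i, q)) ` {1..<p}"
  define R where "R = (\<lambda>j. (p, j)) ` {1..<q}"
  have fin: "finite D" using young by (rule young_finite)
  have sub: "C \<union> R \<subseteq> D" using above left p_pos q_pos by (auto simp: C_def R_def)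
  have "{(i', j') \<in> D. (i' = p \<and> q \<le> j') \<or> (j' = q \<and> p \<le> i')} = {}"
    using outside by auto
  then have "hook_length D (p, q) = 0" by (simp only: hook_length.simps card.empty)
  then have one: "hook_length (insert (p, q) D) (p, q) = 1"
    by (simp add: hook_length_insert del: hook_length.simps)
  have "of_nat (hook_product (insert (p, q) D)) =
      (\<Prod>b\<in>D. of_nat (hook_length (insert (p, q) D) b) :: 'k)"
    using fin notin one by (simp add: hook_product_def)
  also have "\<dots> = (\<Prod>b\<in>D. of_nat (hook_length D b) * (if b \<in> C \<union> R then ?r b else 1))"
  proof (intro prod.cong refl)
    fix b assume b: "b \<in> D"
    obtain i j where ij: "b = (i, j)" by (cases b)
    have "i \<ge> 1" "j \<ge> 1" using young_pos[OF young] b ij by auto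
    moreover have "\<not> (p \<le> i \<and> q \<le> j)" using outside b ij by auto
    ultimately have "(p = i \<and> j \<le> q) \<or> (q = j \<and> i \<le> p) \<longleftrightarrow> b \<in> C \<union> R"
      using ij by (auto simp: C_def R_def)
    then show "of_nat (hook_length (insert (p, q) D) b) =
        of_nat (hook_length D b) * (if b \<in> C \<union> R then ?r b else 1 :: 'k)"
      using hook_length_pos[OF b] unfolding ij
      by (simp add: hook_length_insert del: hook_length.simps)
  qed
  also have "\<dots> = of_nat (hook_product D) * (\<Prod>b\<in>D. if b \<in> C \<union> R then ?r b else 1)"
    by (simp add: prod.distrib hook_product_def)
  also have "(\<Prod>b\<in>D. if b \<in> C \<union> R then ?r b else 1) = prod ?r (D \<inter> (C \<union> R))"
    using fin by (rule prod.inter_restrict[symmetric])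
  also have "D \<inter> (C \<union> R) = C \<union> R" using sub by blast
  also have "prod ?r (C \<union> R) = prod ?r C * prod ?r R"
    by (rule prod.union_disjoint) (auto simp: C_def R_def)
  also have "prod ?r C = (\<Prod>i\<in>{1..<p}. ?r (i, q))"
    unfolding C_def by (subst prod.reindex) (auto simp: inj_on_def simp del: hook_length.simps)
  also have "prod ?r R = (\<Prod>j\<in>{1..<q}. ?r (p, j))"
    unfolding R_def by (subst prod.reindex) (auto simp: inj_on_def simp del: hook_length.simps)
  finally show ?thesis .
qed

text \<open>
  The quotient of \<open>u * gap_prod D u\<close> by \<open>u - c\<close>, where \<open>c\<close> is the content of the new box, in a form that makes
  sense at \<open>u = c\<close>: the first factor comes from the rectangle spanned by the new box.
\<close>

definition cofactor :: "'k::field_char_0 \<Rightarrow> 'k" where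
  "cofactor u = (u - of_nat q) * (u + of_nat p) / ((u - of_int (content (p, q)))\<^sup>2 - 1) *
    (gap_prod right_part u * gap_prod lower_part u)"

lemma lower_part_flip: "lower_part = flip (added_box.right_part (flip D) p)"
  unfolding lower_part_def added_box.right_part_def[OF flipped] by auto

text \<open>
  At \<open>u = c\<close> the rectangle contributes \<open>p * q\<close>, which cancels the factors \<open>1 / p\<close> and \<open>1 / q\<close> produced by
  \<open>gap_prod_right_part\<close> and by its transpose; the rest is the change of the hook product.
\<close>

lemma cofactor_at_content:
  "(cofactor (of_int (content (p, q))) :: 'k::field_char_0) =
    of_nat (hook_product (insert (p, q) D)) / of_nat (hook_product D)"
proof -
  let ?c = "of_int (content (p, q)) :: 'k"
  have "gap_prod lower_part ?c = gap_prod (added_box.right_part (flip D) p) (- ?c)"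
    using gap_prod_flip[OF lower_part_flip, of "- ?c"] by simp
  also have "- ?c = of_int (content (q, p))" by simp
  finally have lower_part: "of_nat q * gap_prod lower_part ?c =
      (\<Prod>j\<in>{1..<q}. (of_nat (hook_length D (p, j)) + 1) / of_nat (hook_length D (p, j)))"
    using added_box.gap_prod_right_part[OF flipped, where ?'k = 'k]
    by (simp only: hook_length_flip)
  have "(?c - of_nat q) * (?c + of_nat p) / ((?c - ?c)\<^sup>2 - 1) = of_nat p * of_nat q"
    by simp
  then have "cofactor ?c = (of_nat p * gap_prod right_part ?c) * (of_nat q * gap_prod lower_part ?c)"
    unfolding cofactor_def by (simp only: mult.assoc mult.left_commute)
  moreover have "of_nat (hook_product D) \<noteq> (0 :: 'k)"
    using hook_length_pos young_finite[OF young]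
    by (simp add: hook_product_def del: hook_length.simps)
  ultimately show ?thesis
    unfolding lower_part gap_prod_right_part hook_product_insert by simp
qed

lemma content_right_lower: "b \<in> right_part \<union> lower_part \<Longrightarrow> content b \<noteq> content (p, q)"
  using outside by (auto simp: right_part_def lower_part_def)

lemma gap_prod_rectangle:
  fixes u :: "'k::field_char_0"
  assumes "not_int u"
  shows "u * gap_prod ({1..p} \<times> {1..q}) u =
    (u + of_nat p) * (u - of_nat q) / (u - of_int (content (p, q)))"
proof -
  have "gap_prod ({1..p} \<times> {1..q}) u =
      (\<Prod>i=1..p. \<Prod>j=1..q. 1 - 1 / (u - of_int (content (i, j)))\<^sup>2)"
    unfolding gap_prod_def by (subst prod.Sigma) (auto intro!: prod.cong simp del: content.simps)
  also have "\<dots> = (\<Prod>i=1..p. (u + of_nat i) / (u + of_nat (i - 1)) *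
      (1 / ((u - of_nat q + of_nat i) / (u - of_nat q + of_nat (i - 1)))))"
  proof (intro prod.cong refl)
    fix i assume i: "i \<in> {1..p}"
    have "(\<Prod>j=1..q. 1 - 1 / (u - of_int (content (i, j)))\<^sup>2) =
        (\<Prod>j=1..q. 1 - 1 / ((u + of_nat i) - of_nat j)\<^sup>2)"
      by (simp add: algebra_simps)
    also have "\<dots> = ((u + of_nat i) - of_nat q - 1) * (u + of_nat i) /
        (((u + of_nat i) - 1) * ((u + of_nat i) - of_nat q))"
      using not_int_diff_nat[OF not_int_add_nat[OF assms], of i]
      by (intro telescope_gap) auto
    also have "\<dots> = (u + of_nat i) / (u + of_nat (i - 1)) *
      (1 / ((u - of_nat q + of_nat i) / (u - of_nat q + of_nat (i - 1))))"
      using i by (simp add: of_nat_diff algebra_simps)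
    finally show "(\<Prod>j=1..q. 1 - 1 / (u - of_int (content (i, j)))\<^sup>2) = \<dots>" .
  qed
  also have "\<dots> = (\<Prod>i=1..p. (u + of_nat i) / (u + of_nat (i - 1))) *
      (1 / (\<Prod>i=1..p. (u - of_nat q + of_nat i) / (u - of_nat q + of_nat (i - 1))))"
    by (simp only: prod.distrib prod_dividef prod.neutral_const)
  also have "(\<Prod>i=1..p. (u + of_nat i) / (u + of_nat (i - 1))) = (u + of_nat p) / (u + of_nat 0)"
    using not_int_diff[OF not_int_add_nat[OF assms], of _ 0] by (intro telescope_ratio) simp
  also have "(\<Prod>i=1..p. (u - of_nat q + of_nat i) / (u - of_nat q + of_nat (i - 1))) =
      (u - of_nat q + of_nat p) / (u - of_nat q + of_nat 0)"
    using not_int_diff[OF not_int_add_nat[OF assms], of _ "int q"]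
    by (intro telescope_ratio) (simp add: algebra_simps)
  finally have *: "gap_prod ({1..p} \<times> {1..q}) u = (u + of_nat p) / (u + of_nat 0) *
      (1 / ((u - of_nat q + of_nat p) / (u - of_nat q + of_nat 0)))" .
  have "u - of_nat q + of_nat p = u - of_int (content (p, q))" by simp
  then show ?thesis
    unfolding * using not_int_diff[OF assms, of 0] by (simp del: content.simps)
qed

lemma gap_prod_cofactor:
  fixes u :: "'k::field_char_0"
  assumes "not_int u"
  shows "u * gap_prod D u = (u - of_int (content (p, q))) * cofactor u"
proof -
  let ?c = "of_int (content (p, q)) :: 'k"
  let ?Q = "{1..p} \<times> {1..q} - {(p, q)}"
  have D: "D = ?Q \<union> (right_part \<union> lower_part)"
  proof (intro equalityI subsetI)
    fix b assume "b \<in> D"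
    then show "b \<in> ?Q \<union> (right_part \<union> lower_part)"
      using young_pos[OF young] notin by (cases b) (fastforce simp: right_part_def lower_part_def)
  next
    fix b assume "b \<in> ?Q \<union> (right_part \<union> lower_part)"
    then show "b \<in> D"
    proof (cases "b \<in> right_part \<union> lower_part")
      case False
      then have "b \<in> ?Q" using \<open>b \<in> ?Q \<union> (right_part \<union> lower_part)\<close> by blast
      moreover obtain i j where "b = (i, j)" by (cases b)
      ultimately show ?thesis using above[of i j] left[of i j] by (cases "i < p") auto
    qed (auto simp: right_part_def lower_part_def)
  qed
  have fin: "finite right_part" "finite lower_part"
    using young_finite[OF young] by (auto simp: right_part_def lower_part_def elim!: rev_finite_subset)
  have disj: "right_part \<inter> lower_part = {}"
    using outside by (auto simp: right_part_def lower_part_def)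
  have u: "u - ?c \<noteq> 0" "(u - ?c)\<^sup>2 - 1 \<noteq> 0"
  proof -
    show "u - ?c \<noteq> 0" using not_int_diff[OF assms] .
    have "(u - ?c)\<^sup>2 - 1 = (u - of_int (content (p, q) + 1)) * (u - of_int (content (p, q) - 1))"
      by (simp add: power2_eq_square algebra_simps)
    then show "(u - ?c)\<^sup>2 - 1 \<noteq> 0"
      by (simp only: mult_eq_0_iff not_int_diff[OF assms]) simp
  qed
  have "gap_prod D u = gap_prod ?Q u * gap_prod (right_part \<union> lower_part) u"
    unfolding gap_prod_def by (subst D, rule prod.union_disjoint) (use fin in \<open>auto simp: right_part_def lower_part_def\<close>)
  also have "gap_prod (right_part \<union> lower_part) u = gap_prod right_part u * gap_prod lower_part u"
    unfolding gap_prod_def by (rule prod.union_disjoint[OF fin disj])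
  finally have split: "u * gap_prod D u = u * gap_prod ?Q u * (gap_prod right_part u * gap_prod lower_part u)"
    by (simp add: mult.assoc)
  have "gap_prod ({1..p} \<times> {1..q}) u = (1 - 1 / (u - ?c)\<^sup>2) * gap_prod ?Q u"
    unfolding gap_prod_def using p_pos q_pos by (subst prod.remove[of _ "(p, q)"]) auto
  then have "u * gap_prod ?Q u * (1 - 1 / (u - ?c)\<^sup>2) = (u + of_nat p) * (u - of_nat q) / (u - ?c)"
    using gap_prod_rectangle[OF assms] by (simp add: mult.assoc mult.commute mult.left_commute)
  moreover have "1 - 1 / (u - ?c)\<^sup>2 = ((u - ?c)\<^sup>2 - 1) / (u - ?c)\<^sup>2"
    using u by (simp add: diff_divide_distrib)
  ultimately have "u * gap_prod ?Q u * (((u - ?c)\<^sup>2 - 1) / (u - ?c)\<^sup>2) =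
     (u + of_nat p) * (u - of_nat q) / (u - ?c)" by (simp only:)
  moreover have "x = d * (y * z / w)"
    if "x * (w / d\<^sup>2) = z * y / d" "w \<noteq> 0" "d \<noteq> 0" for x y z w d :: 'k
    using that by (simp add: field_simps power2_eq_square)
  ultimately have "u * gap_prod ?Q u =
     (u - ?c) * ((u - of_nat q) * (u + of_nat p) / ((u - ?c)\<^sup>2 - 1))" using u by blast
  then show ?thesis
    unfolding split cofactor_def by (simp only: mult.assoc)
qed

end


section \<open>Polynomials in a Jucys--Murphy element\<close>

definition jm_poly :: "nat \<Rightarrow> int list \<Rightarrow> 'k::comm_ring_1 group_algebra" where
  "jm_poly n as = prod_list (map (\<lambda>a. jm n n - of_int a) as)"

lemma jm_poly_Nil [simp]: "jm_poly n [] = 1"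
  and jm_poly_Cons: "jm_poly n (a # as) = (jm n n - of_int a) * jm_poly n as"
  and jm_poly_append: "jm_poly n (as @ bs) = jm_poly n as * jm_poly n bs"
  by (simp_all add: jm_poly_def)

lemma jm_poly_commute:
  assumes "X * jm n n = jm n n * X"
  shows "X * jm_poly n as = jm_poly n as * (X :: 'k::comm_ring_1 group_algebra)"
proof (induction as)
  case (Cons a as)
  have "X * (jm n n - of_int a) = (jm n n - of_int a) * X"
    by (simp add: assms right_diff_distrib left_diff_distrib scalar_commute flip: scalar_of_int)
  then have "X * ((jm n n - of_int a) * jm_poly n as) = (jm n n - of_int a) * (X * jm_poly n as)"
    by (simp flip: mult.assoc)
  then show ?case by (simp add: jm_poly_Cons Cons mult.assoc)
qed simp

lemma jm_poly_snoc: "jm_poly n (as @ [a]) = jm_poly n as * (jm n n - of_int a)"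
  by (simp add: jm_poly_append jm_poly_Cons)

lemma jm_poly_Cons': "jm_poly n (a # as) = jm_poly n as * (jm n n - of_int a :: 'k::comm_ring_1 group_algebra)"
  using jm_poly_commute[of "jm n n - of_int a" n as]
  by (simp add: jm_poly_Cons right_diff_distrib left_diff_distrib scalar_commute flip: scalar_of_int)

lemma jm_poly_eigen:
  assumes "E * jm n n = scalar (of_int c) * (E :: 'k::comm_ring_1 group_algebra)"
  shows "E * jm_poly n as = scalar (\<Prod>a\<leftarrow>as. of_int (c - a)) * E"
proof (induction as)
  case (Cons a as)
  have "E * (jm n n - of_int a) = scalar (of_int (c - a)) * E"
    by (simp add: assms right_diff_distrib left_diff_distrib scalar_diff scalar_commute[of E]
        flip: scalar_of_int)
  then have "E * ((jm n n - of_int a) * jm_poly n as) = scalar (of_int (c - a)) * (E * jm_poly n as)"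
    by (simp only: mult.assoc[symmetric])
  then show ?case by (simp only: Cons jm_poly_Cons scalar_mult list.map prod_list.Cons mult.assoc)
qed simp

text \<open>
  The quotient of \<open>g(u) - g(x\<^sub>n)\<close> by \<open>u - x\<^sub>n\<close> for \<open>g(z) = \<Prod>\<^sub>a (z - a)\<close>, arranged so that it
  reduces modulo \<open>u - a\<close>, with \<open>a\<close> the first root, to the product over the other roots.
\<close>

primrec jm_quot :: "nat \<Rightarrow> int list \<Rightarrow> 'k \<Rightarrow> 'k::comm_ring_1 group_algebra" where
  "jm_quot n [] u = 0"
| "jm_quot n (a # as) u = jm_poly n as + scalar (u - of_int a) * jm_quot n as u"

lemma jm_quot:
  "jm_quot n as u * (scalar u - jm n n) =
    scalar (\<Prod>a\<leftarrow>as. u - of_int a) - (jm_poly n as :: 'k::comm_ring_1 group_algebra)"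
proof (induction as)
  case (Cons a as)
  let ?x = "jm n n :: 'k group_algebra"
  have "jm_quot n (a # as) u * (scalar u - ?x) =
      jm_poly n as * (scalar u - ?x) + scalar (u - of_int a) * (jm_quot n as u * (scalar u - ?x))"
    by (simp only: jm_quot.simps distrib_right mult.assoc)
  also have "\<dots> = jm_poly n as * (scalar u - ?x) + scalar (u - of_int a) *
      (scalar (\<Prod>a\<leftarrow>as. u - of_int a) - jm_poly n as)"
    by (simp only: Cons)
  also have "\<dots> = scalar ((u - of_int a) * (\<Prod>a\<leftarrow>as. u - of_int a))
      + (jm_poly n as * (scalar u - ?x) - jm_poly n as * scalar (u - of_int a))"
    by (simp only: right_diff_distrib scalar_mult scalar_commute[of "jm_poly n as" "u - of_int a"]) simp
  also have "jm_poly n as * (scalar u - ?x) - jm_poly n as * scalar (u - of_int a) =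
      - jm_poly n (a # as)"
    by (simp add: jm_poly_Cons' scalar_diff scalar_of_int right_diff_distrib)
  finally show ?case by simp
qed simp

subsection \<open>The part of the group algebra that fixes large points\<close>

text \<open>
  The group algebra of the permutations of \<open>{..n}\<close>.
\<close>

definition in_sym :: "nat \<Rightarrow> 'k::zero group_algebra \<Rightarrow> bool" where
  "in_sym n X \<longleftrightarrow> (\<forall>p\<in>Poly_Mapping.keys X. \<forall>m>n. Perm.apply p m = m)"

lemma in_sym_mono: "in_sym m X \<Longrightarrow> m \<le> n \<Longrightarrow> in_sym n X"
  by (auto simp: in_sym_def)

lemma in_sym_scalar: "in_sym n (scalar c)"
  by (auto simp: in_sym_def scalar_def zero_perm_def split: if_splits)

lemma in_sym_1: "in_sym n (1 :: 'k::comm_ring_1 group_algebra)"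
  using in_sym_scalar[of n "1 :: 'k"] by simp

lemma in_sym_transp: "i \<le> n \<Longrightarrow> j \<le> n \<Longrightarrow> in_sym n (transp i j :: 'k::comm_ring_1 group_algebra)"
  by (auto simp: in_sym_def transp_def)

lemma in_sym_add:
  fixes X :: "'k::comm_ring_1 group_algebra"
  shows "in_sym n X \<Longrightarrow> in_sym n Y \<Longrightarrow> in_sym n (X + Y)"
  using keys_add[of X Y] unfolding in_sym_def by blast

lemma in_sym_diff:
  fixes X :: "'k::comm_ring_1 group_algebra"
  assumes "in_sym n X" "in_sym n Y"
  shows "in_sym n (X - Y)"
  unfolding in_sym_def
proof (intro ballI allI impI)
  fix p m assume "p \<in> Poly_Mapping.keys (X - Y)" "n < m"
  then have "p \<in> Poly_Mapping.keys X \<or> p \<in> Poly_Mapping.keys Y"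
    by (auto simp: in_keys_iff lookup_minus)
  then show "Perm.apply p m = m" using assms \<open>n < m\<close> unfolding in_sym_def by blast
qed

lemma in_sym_sum:
  "(\<And>i. i \<in> A \<Longrightarrow> in_sym n (X i :: 'k::comm_ring_1 group_algebra)) \<Longrightarrow> in_sym n (sum X A)"
  by (induction A rule: infinite_finite_induct) (auto simp: in_sym_add, auto simp: in_sym_def)

lemma in_sym_mult:
  fixes X :: "'k::comm_ring_1 group_algebra"
  assumes "in_sym n X" "in_sym n Y"
  shows "in_sym n (X * Y)"
  unfolding in_sym_def
proof (intro ballI allI impI)
  fix p m assume "p \<in> Poly_Mapping.keys (X * Y)" "n < m"
  then obtain a b where "p = a + b" "a \<in> Poly_Mapping.keys X" "b \<in> Poly_Mapping.keys Y"
    using keys_mult[of X Y] by blast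
  then show "Perm.apply p m = m"
    using assms \<open>n < m\<close> by (simp add: in_sym_def plus_perm_def apply_times)
qed

lemma in_sym_jm: "in_sym n (jm n n :: 'k::comm_ring_1 group_algebra)"
  unfolding jm_def by (intro in_sym_sum in_sym_transp) auto

lemma in_sym_jm_poly: "in_sym n (jm_poly n as :: 'k::comm_ring_1 group_algebra)"
proof (induction as)
  case (Cons a as)
  then show ?case
    unfolding jm_poly_Cons scalar_of_int[symmetric]
    by (intro in_sym_mult in_sym_diff in_sym_jm in_sym_scalar)
qed (simp add: in_sym_1)

lemma lookup_mult_transp:
  fixes X :: "'k::comm_ring_1 group_algebra"
  shows "Poly_Mapping.lookup (X * transp i j) p = Poly_Mapping.lookup X (p + Perm.swap i j)"
proof -
  have "X * transp i j =
      (\<Sum>m\<in>Poly_Mapping.keys X. Poly_Mapping.single (m + Perm.swap i j) (Poly_Mapping.lookup X m))"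
    by (subst sum_singles[of X]) (simp add: sum_distrib_right transp_def mult_single)
  also have "Poly_Mapping.lookup \<dots> p =
      (\<Sum>m\<in>Poly_Mapping.keys X. if m = p + Perm.swap i j then Poly_Mapping.lookup X m else 0)"
  proof -
    have "m + Perm.swap i j = p \<longleftrightarrow> m = p + Perm.swap i j" for m
      by (auto simp: plus_perm_def mult.assoc)
    then show ?thesis by (simp add: lookup_sum lookup_single when_def)
  qed
  finally show ?thesis by (auto simp: sum.delta in_keys_iff)
qed

text \<open>
  A permutation in the support of the product maps some point of \<open>{1..<k} \<union> {n}\<close> to \<open>n\<close>; this is inherited when
  the next factor is multiplied on.  As \<open>s\<^sub>k\<^sub>n\<close> maps only \<open>k\<close> to \<open>n\<close>, it is not in the support, and the
  next summand does not contribute to the coefficient of the neutral element.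
\<close>

lemma lookup_column_0:
  fixes E :: "'k::comm_ring_1 group_algebra"
  assumes "in_sym (n - 1) E" "1 \<le> n" "k \<le> n"
  shows "Poly_Mapping.lookup (E * prod_list (map (\<lambda>i. 1 - scalar (c i) * transp i n) [1..<k])) 0 =
      Poly_Mapping.lookup E 0 \<and>
    (\<forall>p \<in> Poly_Mapping.keys (E * prod_list (map (\<lambda>i. 1 - scalar (c i) * transp i n) [1..<k])).
       \<exists>i\<in>{1..<k} \<union> {n}. Perm.apply p i = n)"
  using assms(3)
proof (induction k)
  case 0
  then show ?case using assms(1,2) by (auto simp: in_sym_def)
next
  case (Suc k)
  show ?case
  proof (cases "k = 0")
    case True
    then show ?thesis using assms(1,2) by (auto simp: in_sym_def)
  next
    case False
    define Y where "Y = E * prod_list (map (\<lambda>i. 1 - scalar (c i) * transp i n) [1..<k])"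
    have Y: "Poly_Mapping.lookup Y 0 = Poly_Mapping.lookup E 0"
      "\<And>p. p \<in> Poly_Mapping.keys Y \<Longrightarrow> \<exists>i\<in>{1..<k} \<union> {n}. Perm.apply p i = n"
      using Suc unfolding Y_def by auto
    let ?Z = "Y - scalar (c k) * (Y * transp k n)"
    have Z: "E * prod_list (map (\<lambda>i. 1 - scalar (c i) * transp i n) [1..<Suc k]) = ?Z"
      using False
      by (simp add: Y_def right_diff_distrib scalar_left_commute[of E] mult.assoc
          scalar_left_commute[of "prod_list (map (\<lambda>i. 1 - scalar (c i) * transp i n) [Suc 0..<k])"])
    have "Perm.swap k n \<notin> Poly_Mapping.keys Y"
    proof
      assume "Perm.swap k n \<in> Poly_Mapping.keys Y"
      then obtain i where "i \<in> {1..<k} \<union> {n}" "Perm.apply (Perm.swap k n) i = n" using Y(2) by blast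
      then show False using Suc.prems by simp
    qed
    then have "Poly_Mapping.lookup ?Z 0 = Poly_Mapping.lookup E 0"
      by (simp add: lookup_minus lookup_mult_transp Y(1) in_keys_iff)
    moreover have "\<exists>i\<in>{1..<Suc k} \<union> {n}. Perm.apply p i = n" if "p \<in> Poly_Mapping.keys ?Z" for p
    proof (cases "p \<in> Poly_Mapping.keys Y")
      case True
      then show ?thesis using Y(2)[OF True] by auto
    next
      case False
      then have "p + Perm.swap k n \<in> Poly_Mapping.keys Y"
        using that by (auto simp: in_keys_iff lookup_minus lookup_mult_transp)
      from Y(2)[OF this] obtain i where i: "i \<in> {1..<k} \<union> {n}" "Perm.apply (p + Perm.swap k n) i = n"
        by blast
      then have "Perm.apply p (Perm.apply (Perm.swap k n) i) = n"
        by (simp add: plus_perm_def apply_times)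
      then show ?thesis
        using i(1) Suc.prems \<open>k \<noteq> 0\<close> by (cases "i = n") (auto intro: bexI[of _ k])
    qed
    ultimately show ?thesis unfolding Z by blast
  qed
qed

section \<open>The characteristic identity\<close>

subsection \<open>Limits along half-integers\<close>

text \<open>
  A sequence that tends to infinity and avoids all the poles.
\<close>

definition half_int :: "nat \<Rightarrow> complex" where
  "half_int N = of_nat N + 1 / 2"

lemma not_int_half_int: "not_int (half_int N)"
  unfolding not_int_def
proof
  fix z
  show "half_int N \<noteq> of_int z"
  proof
    assume "half_int N = of_int z"
    then have "of_int (2 * z) = (of_int (2 * int N + 1) :: complex)"
      by (simp add: half_int_def field_simps)
    then have "2 * z = 2 * int N + 1" by (simp only: of_int_eq_iff)
    then show False by presburger
  qed
qed

lemma half_int_at_infinity: "filterlim half_int at_infinity sequentially"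
  unfolding half_int_def[abs_def]
  by (rule tendsto_add_filterlim_at_infinity'[OF tendsto_of_nat tendsto_const])

lemma inverse_half_int_shift: "(\<lambda>N. 1 / (half_int N - c)) \<longlonglongrightarrow> 0"
proof -
  have "filterlim (\<lambda>N. half_int N + - c) at_infinity sequentially"
    by (rule tendsto_add_filterlim_at_infinity'[OF half_int_at_infinity tendsto_const])
  then have "(\<lambda>N. inverse (half_int N + - c)) \<longlonglongrightarrow> 0"
    by (rule filterlim_compose[OF tendsto_inverse_0])
  then show ?thesis by (simp add: field_simps)
qed

lemma poly_tendsto_0:
  assumes "(\<lambda>N. poly p (half_int N)) \<longlonglongrightarrow> 0"
  shows "p = 0"
proof (cases p)
  case (pCons a q)
  have "q = 0"
  proof (rule ccontr)
    assume "q \<noteq> 0"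
    then obtain r where r: "\<And>z. r \<le> norm z \<Longrightarrow> 1 \<le> norm (poly p z)"
      using poly_infinity[of q 1 a] pCons by auto
    have "eventually (\<lambda>z::complex. r \<le> norm z) at_infinity"
      by (auto simp: eventually_at_infinity)
    then have "eventually (\<lambda>N. r \<le> norm (half_int N)) sequentially"
      using half_int_at_infinity by (auto simp: filterlim_iff)
    moreover have "eventually (\<lambda>N. norm (poly p (half_int N)) < 1) sequentially"
      using tendstoD[OF assms, of 1] by simp
    ultimately have "eventually (\<lambda>N::nat. False) sequentially"
      by eventually_elim (use r in force)
    then show False by simp
  qed
  moreover from this have "a = 0" using assms pCons by (simp add: tendsto_const_iff)
  ultimately show ?thesis using pCons by simp
qed

lemma column_tendsto:
  fixes c :: "nat \<Rightarrow> nat \<Rightarrow> complex"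
  assumes "\<And>i. i \<in> set xs \<Longrightarrow> (\<lambda>N. c N i) \<longlonglongrightarrow> 0"
  shows "(\<lambda>N. Poly_Mapping.lookup (Y * prod_list (map (\<lambda>i. 1 - scalar (c N i) * transp i n) xs)) p)
    \<longlonglongrightarrow> Poly_Mapping.lookup Y p"
  using assms
proof (induction xs arbitrary: Y)
  case (Cons i xs)
  let ?P = "\<lambda>N. prod_list (map (\<lambda>i. 1 - scalar (c N i) * transp i n) xs)"
  have "Poly_Mapping.lookup (Y * ((1 - scalar (c N i) * transp i n) * ?P N)) p =
      Poly_Mapping.lookup (Y * ?P N) p - c N i * Poly_Mapping.lookup ((Y * transp i n) * ?P N) p" for N
    by (simp add: left_diff_distrib right_diff_distrib mult.assoc scalar_left_commute[of Y] lookup_minus)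
  moreover have "(\<lambda>N. Poly_Mapping.lookup (Y * ?P N) p -
      c N i * Poly_Mapping.lookup ((Y * transp i n) * ?P N) p)
    \<longlonglongrightarrow> Poly_Mapping.lookup Y p - 0 * Poly_Mapping.lookup (Y * transp i n) p"
    using Cons by (intro tendsto_intros) auto
  ultimately show ?case by simp
qed simp

subsection \<open>The annihilating polynomial\<close>

lemma star_jm: "star (jm n n) = jm n n"
  by (simp add: jm_def star_sum star_transp)

lemma star_diff: "star (X - Y) = star X - star Y"
  using star_add[of "X - Y" Y] by simp

lemma star_of_int: "star (of_int a) = of_int a"
  by (simp add: star_scalar flip: scalar_of_int)

lemma star_jm_poly: "star (jm_poly n as) = jm_poly n as"
proof (induction as)
  case (Cons a as)
  then show ?case
    by (simp add: jm_poly_Cons star_mult star_diff star_jm star_of_int flip: jm_poly_Cons')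
qed (use star_scalar[of 1] in simp)

text \<open>
  Let \<open>\<psi>\<^sub>q(u) = \<tau> (E q(x\<^sub>n) R(u)) / f(u)\<close>, which is \<open>\<tau> (E q(x\<^sub>n) (u - x\<^sub>n)\<^sup>-\<^sup>1)\<close> by \<open>weight_times_column\<close>.
  It tends to \<open>0\<close> as \<open>u\<close> tends to infinity, and \<open>\<psi>\<^sub>q\<^sub>'(u) = (u - a) \<psi>\<^sub>q(u) - \<tau> (E q(x\<^sub>n))\<close> for
  \<open>q'(z) = (z - a) q(z)\<close>.  Starting from \<open>\<psi>\<^sub>1 = \<tau> (E) / f\<close>, this recursion shows that \<open>\<psi>\<^sub>g\<close> differs from
  \<open>g \<tau> (E) / f = h \<tau> (E)\<close> by a polynomial; being a polynomial that tends to \<open>0\<close>, it vanishes.  The recursion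
  now shows that \<open>\<psi>\<^sub>g\<^sub>q\<close> and \<open>\<tau> (E g(x\<^sub>n) q(x\<^sub>n))\<close> vanish for all products \<open>q\<close> of linear factors.  Take \<open>q = g\<close>.
\<close>

lemma characteristic_identity:
  fixes E :: "complex group_algebra" and w :: "nat \<Rightarrow> int" and h :: "complex poly"
  assumes weight: "\<And>i. 1 \<le> i \<Longrightarrow> i < n \<Longrightarrow> E * jm i i = scalar (of_int (w i)) * E"
    and n: "1 \<le> n" and sym: "in_sym (n - 1) E"
    and idem: "E * E = E" and selfadj: "star E = E" and comm: "E * jm n n = jm n n * E"
    and h: "\<And>u. not_int u \<Longrightarrow>
      u * (\<Prod>i\<in>{1..<n}. 1 - 1 / (u - of_int (w i))\<^sup>2) * poly h u = (\<Prod>a\<leftarrow>as. u - of_int a)"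
  shows "E * jm_poly n as = 0"
proof -
  define P where "P N = prod_list (map (\<lambda>i. 1 - scalar (1 / (of_int (w i) - half_int N)) * transp i n) [1..<n])"
    for N
  define f where "f N = half_int N * (\<Prod>i\<in>{1..<n}. 1 - 1 / (half_int N - of_int (w i))\<^sup>2)" for N
  define psi where "psi xs N = Poly_Mapping.lookup (E * jm_poly n xs * P N) 0 / f N" for xs N
  define tau where "tau xs = Poly_Mapping.lookup (E * jm_poly n xs) 0" for xs
  have fh: "f N * poly h (half_int N) = (\<Prod>a\<leftarrow>as. half_int N - of_int a)" for N
    unfolding f_def by (rule h[OF not_int_half_int])
  have "(\<Prod>a\<leftarrow>as. half_int N - of_int a) \<noteq> 0" for N
    using not_int_diff[OF not_int_half_int] by (induction as) auto
  then have f0: "f N \<noteq> 0" for N using fh by (metis mult_zero_left)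
  have wt: "E * jm_poly n xs * jm i i = scalar (of_int (w i)) * (E * jm_poly n xs)"
    if "1 \<le> i" "i < n" for xs i
  proof -
    have "E * jm_poly n xs * jm i i = (E * jm i i) * jm_poly n xs"
      by (simp add: jm_poly_commute[of "jm i i" n xs, OF jm_commute] mult.assoc)
    then show ?thesis by (simp add: weight[OF that] mult.assoc)
  qed
  have "half_int N \<noteq> of_int z" for N z
    using not_int_half_int[of N] by (simp add: not_int_def)
  note half_ne = this this[symmetric]
  \<comment> \<open>Write \<open>x\<^sub>n - a = (u - a) - (u - x\<^sub>n)\<close> and apply the resolvent identity to the second summand.\<close>
  have step: "psi (xs @ [a]) N = (half_int N - of_int a) * psi xs N - tau xs" for xs a N
  proof -
    let ?Y = "E * jm_poly n xs" and ?u = "half_int N"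
    have "(scalar ?u * ?Y - ?Y * jm n n) * P N = scalar (f N) * ?Y"
      unfolding P_def f_def by (rule weight_times_column[OF wt]) (use half_ne in auto)
    moreover have "E * jm_poly n (xs @ [a]) =
        scalar (?u - of_int a) * ?Y - (scalar ?u * ?Y - ?Y * jm n n)"
      by (simp add: jm_poly_snoc scalar_diff right_diff_distrib left_diff_distrib mult.assoc
          scalar_commute[of E] scalar_commute[of "jm_poly n xs"] scalar_left_commute[of E]
          flip: scalar_of_int)
    ultimately have "E * jm_poly n (xs @ [a]) * P N =
        scalar (?u - of_int a) * (?Y * P N) - scalar (f N) * ?Y"
      by (simp only: left_diff_distrib mult.assoc)
    then show ?thesis
      using f0[of N] by (simp add: psi_def tau_def lookup_minus diff_divide_distrib)
  qed
  have start: "psi [] N = tau [] / f N" for N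
    using lookup_column_0[OF sym n order_refl, of "\<lambda>i. 1 / (of_int (w i) - half_int N)"]
    by (simp add: psi_def tau_def P_def)
  have lim: "psi xs \<longlonglongrightarrow> 0" for xs
  proof -
    have c: "(\<lambda>N. 1 / (of_int (w i) - half_int N)) \<longlonglongrightarrow> 0" for i
    proof -
      have "- (1 / (half_int N - of_int (w i))) = 1 / (of_int (w i) - half_int N)" for N
        by (simp add: minus_divide_right)
      then show ?thesis
        using tendsto_minus[OF inverse_half_int_shift[of "of_int (w i)"]] by simp
    qed
    have "(\<lambda>N. Poly_Mapping.lookup (E * jm_poly n xs * P N) 0) \<longlonglongrightarrow> tau xs"
      unfolding P_def tau_def by (rule column_tendsto) (rule c)
    moreover have "(\<lambda>N. \<Prod>i\<in>{1..<n}. 1 - (1 / (half_int N - of_int (w i)))\<^sup>2)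
        \<longlonglongrightarrow> (\<Prod>i\<in>{1..<n}. 1 - 0\<^sup>2)"
      by (intro tendsto_intros inverse_half_int_shift)
    moreover have "(\<lambda>N. 1 / (half_int N - 0)) \<longlonglongrightarrow> 0"
      by (rule inverse_half_int_shift)
    ultimately have "(\<lambda>N. Poly_Mapping.lookup (E * jm_poly n xs * P N) 0 * (1 / (half_int N - 0)) *
        inverse (\<Prod>i\<in>{1..<n}. 1 - (1 / (half_int N - of_int (w i)))\<^sup>2)) \<longlonglongrightarrow>
        tau xs * 0 * inverse (\<Prod>i\<in>{1..<n}. 1 - 0\<^sup>2)"
      by (intro tendsto_intros) (auto intro: inverse_half_int_shift)
    then show ?thesis
      by (simp add: psi_def[abs_def] f_def power_one_over field_simps)
  qed
  have "\<exists>p. \<forall>N. psi xs N = (\<Prod>a\<leftarrow>xs. half_int N - of_int a) * (tau [] / f N) - poly p (half_int N)" for xs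
  proof (induction xs rule: rev_induct)
    case Nil
    show ?case by (rule exI[of _ 0]) (simp add: start)
  next
    case (snoc a xs)
    then obtain p where p: "\<And>N. psi xs N =
        (\<Prod>a\<leftarrow>xs. half_int N - of_int a) * (tau [] / f N) - poly p (half_int N)" by blast
    show ?case
      by (rule exI[of _ "[:- of_int a, 1:] * p + [:tau xs:]"]) (simp add: step p algebra_simps diff_divide_distrib)
  qed
  then obtain p where p: "\<And>N. psi as N =
      (\<Prod>a\<leftarrow>as. half_int N - of_int a) * (tau [] / f N) - poly p (half_int N)" by blast
  have poly: "psi as N = poly (smult (tau []) h - p) (half_int N)" for N
    unfolding p using f0[of N] by (simp flip: fh)
  have "smult (tau []) h - p = 0"
    using lim[of as] by (intro poly_tendsto_0) (simp add: poly[abs_def])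
  then have psi0: "psi as N = 0" for N unfolding poly by simp
  have "(\<forall>N. psi (as @ ys) N = 0) \<and> tau (as @ ys) = 0" for ys
  proof -
    \<comment> \<open>If \<open>\<psi>\<^sub>q\<close> vanishes then the recursion makes the next function constant, hence \<open>0\<close> by its limit.\<close>
    have tau0: "tau zs = 0" if "\<And>N. psi zs N = 0" for zs
    proof -
      have "psi (zs @ [0]) = (\<lambda>N. - tau zs)" by (simp add: step that fun_eq_iff)
      then show ?thesis using lim[of "zs @ [0]"] by (simp add: tendsto_const_iff)
    qed
    have "\<forall>N. psi (as @ ys) N = 0"
    proof (induction ys rule: rev_induct)
      case (snoc a ys)
      then show ?case
        using tau0[of "as @ ys"] step[of "as @ ys" a] by simp
    qed (simp add: psi0)
    then show ?thesis using tau0 by blast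
  qed
  then have tau: "tau (as @ as) = 0" by blast
  have cE: "E * jm_poly n as = jm_poly n as * E" for as
    by (rule jm_poly_commute[OF comm])
  \<comment> \<open>With \<open>W = E g(x\<^sub>n)\<close> one has \<open>W W\<^sup>* = E g(x\<^sub>n)\<^sup>2\<close>, to which \<open>tau\<close> applies.\<close>
  have "E * jm_poly n as * star (E * jm_poly n as) = E * (jm_poly n as * jm_poly n as * E)"
    by (simp add: star_mult star_jm_poly selfadj mult.assoc)
  also have "\<dots> = E * jm_poly n (as @ as)"
    by (simp only: jm_poly_append[symmetric] cE[symmetric]) (simp only: mult.assoc[symmetric] idem)
  finally show ?thesis
    using tau by (intro star_positive) (simp add: tau_def)
qed

text \<open>
  The element \<open>Y = E (g(u) - g(x\<^sub>n)) / (u - x\<^sub>n)\<close>, with \<open>g\<close> the polynomial annihilating \<open>x\<^sub>n\<close> on \<open>E\<close>, satisfies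
  \<open>Y (u - x\<^sub>n) = g(u) E\<close> and has the same weights as \<open>E\<close>.  So \<open>weight_times_column\<close> for \<open>Y\<close> reads
  \<open>g(u) E R = f(u) Y\<close>, and the factor \<open>u - c\<close> can be cancelled from \<open>f / g\<close>.
\<close>

lemma weight_times_column_regular:
  fixes E :: "'k::field group_algebra" and w :: "nat \<Rightarrow> 'k"
  assumes "\<And>i. 1 \<le> i \<Longrightarrow> i < n \<Longrightarrow> E * jm i i = scalar (w i) * E"
    and "\<And>i. 1 \<le> i \<Longrightarrow> i < n \<Longrightarrow> w i \<noteq> u"
    and zero: "E * jm_poly n (c # as) = 0"
    and f: "u * (\<Prod>i\<in>{1..<n}. 1 - 1 / (u - w i)\<^sup>2) = (u - of_int c) * r"
    and u: "u \<noteq> of_int c" "(\<Prod>a\<leftarrow>as. u - of_int a) \<noteq> 0"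
  shows "E * prod_list (map (\<lambda>i. 1 - scalar (1 / (w i - u)) * transp i n) [1..<n]) =
    scalar (r / (\<Prod>a\<leftarrow>as. u - of_int a)) * (E * jm_poly n as + scalar (u - of_int c) * (E * jm_quot n as u))"
proof (rule scalar_cancel)
  let ?g = "\<Prod>a\<leftarrow>as. u - of_int a" and ?x = "jm n n :: 'k group_algebra"
  let ?P = "prod_list (map (\<lambda>i. 1 - scalar (1 / (w i - u)) * transp i n) [1..<n])"
  let ?Y = "E * jm_quot n (c # as) u"
  show "(u - of_int c) * ?g \<noteq> 0" using u by simp
  have quot: "jm i i * jm_quot n bs u = jm_quot n bs u * (jm i i :: 'k group_algebra)" for i bs
    by (induction bs) (simp_all add: distrib_left distrib_right jm_poly_commute jm_commute
        scalar_left_commute[of "jm i i"] mult.assoc)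
  have wt: "?Y * jm i i = scalar (w i) * ?Y" if "1 \<le> i" "i < n" for i
    by (simp only: mult.assoc quot[symmetric]) (simp only: assms(1)[OF that] flip: mult.assoc)
  have "scalar u * ?Y - ?Y * ?x = E * (jm_quot n (c # as) u * (scalar u - ?x))"
    by (simp only: right_diff_distrib scalar_commute[of "jm_quot n (c # as) u"] scalar_left_commute[of E] mult.assoc)
  also have "\<dots> = scalar ((u - of_int c) * ?g) * E"
    unfolding jm_quot by (simp add: right_diff_distrib zero scalar_commute[of E])
  finally have "scalar ((u - of_int c) * ?g) * (E * ?P) = (scalar u * ?Y - ?Y * ?x) * ?P"
    by (simp only: mult.assoc)
  also have "\<dots> = scalar ((u - of_int c) * r) * ?Y"
    unfolding f[symmetric] by (rule weight_times_column[OF wt assms(2)])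
  also have "?Y = E * jm_poly n as + scalar (u - of_int c) * (E * jm_quot n as u)"
    by (simp add: distrib_left scalar_left_commute[of E])
  finally show "scalar ((u - of_int c) * ?g) * (E * ?P) = scalar ((u - of_int c) * ?g) *
      (scalar (r / ?g) * (E * jm_poly n as + scalar (u - of_int c) * (E * jm_quot n as u)))"
    using u by (simp flip: mult.assoc scalar_mult)
qed


section \<open>The seminormal idempotents\<close>

text \<open>
  A box to the right of or below another one carries a larger entry, so the box of the largest entry is
  a corner.
\<close>

lemma remove_largest_entry:
  assumes "young D" "standard_tableau (Suc m) D T"
  defines "\<alpha> \<equiv> the_inv_into D T (Suc m)"
  shows "\<alpha> \<in> D" "T \<alpha> = Suc m" "\<alpha> \<in> addable (D - {\<alpha>})" "young (D - {\<alpha>})"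
    "standard_tableau m (D - {\<alpha>}) T"
proof -
  have bij: "bij_betw T D {1..Suc m}"
    and row: "\<And>i j j'. (i, j) \<in> D \<Longrightarrow> (i, j') \<in> D \<Longrightarrow> j < j' \<Longrightarrow> T (i, j) < T (i, j')"
    and col: "\<And>i i' j. (i, j) \<in> D \<Longrightarrow> (i', j) \<in> D \<Longrightarrow> i < i' \<Longrightarrow> T (i, j) < T (i', j)"
    using assms(2) by (auto simp: standard_tableau_def)
  show \<alpha>: "\<alpha> \<in> D" and T\<alpha>: "T \<alpha> = Suc m"
    unfolding \<alpha>_def using bij by (auto simp: bij_betw_def intro!: the_inv_into_into f_the_inv_into_f)
  show young: "young (D - {\<alpha>})"
  proof (rule youngI)
    show "finite (D - {\<alpha>})" using young_finite[OF assms(1)] by simp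
    show "1 \<le> i \<and> 1 \<le> j" if "(i, j) \<in> D - {\<alpha>}" for i j
      using that young_pos[OF assms(1)] by auto
    show "(i', j') \<in> D - {\<alpha>}"
      if "(i, j) \<in> D - {\<alpha>}" "1 \<le> i'" "i' \<le> i" "1 \<le> j'" "j' \<le> j" for i j i' j'
    proof -
      have ij: "(i, j) \<in> D" "(i, j) \<noteq> \<alpha>" using that by auto
      have in_D: "(i', j') \<in> D" "(i', j) \<in> D"
        using young_down[OF assms(1) ij(1)] that by auto
      have "T (i, j) \<le> Suc m" using bij ij(1) by (auto simp: bij_betw_def)
      moreover have "T (i, j) \<noteq> T \<alpha>"
        using inj_onD[OF bij_betw_imp_inj_on[OF bij], of "(i, j)" \<alpha>] ij \<alpha> by blast
      moreover have "T (i', j') \<le> T (i', j)" "T (i', j) \<le> T (i, j)"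
        using row[OF in_D] that(5) col[OF in_D(2) ij(1)] that(3)
        by (cases "j' = j"; cases "i' = i"; fastforce)+
      ultimately show ?thesis using in_D(1) T\<alpha> by auto
    qed
  qed
  show "\<alpha> \<in> addable (D - {\<alpha>})"
    using \<alpha> assms(1) by (simp add: addable_iff_young insert_absorb)
  have "bij_betw T (D - {\<alpha>}) ({1..Suc m} - {Suc m})"
    using bij \<alpha> T\<alpha> by (intro bij_betw_DiffI) (auto simp: bij_betw_def)
  then have "bij_betw T (D - {\<alpha>}) {1..m}"
    by (simp add: atLeastAtMostSuc_conv)
  then show "standard_tableau m (D - {\<alpha>}) T"
    using row col by (simp add: standard_tableau_def)
qed

lemma gap_prod_tableau:
  fixes u :: "'k::field_char_0"
  assumes "standard_tableau m D T" "\<And>b. b \<in> D \<Longrightarrow> sigma (T b) = content b"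
  shows "(\<Prod>i\<in>{1..<Suc m}. 1 - 1 / (u - of_int (sigma i))\<^sup>2) = gap_prod D u"
proof -
  have "(\<Prod>b\<in>D. 1 - 1 / (u - of_int (sigma (T b)))\<^sup>2) = (\<Prod>i\<in>{1..m}. 1 - 1 / (u - of_int (sigma i))\<^sup>2)"
    by (rule prod.reindex_bij_betw) (use assms(1) in \<open>simp add: standard_tableau_def\<close>)
  then show ?thesis
    by (simp add: gap_prod_def assms(2) atLeastLessThanSuc_atLeastAtMost)
qed

definition other_contents :: "box set \<Rightarrow> box \<Rightarrow> int list" where
  "other_contents M \<alpha> = sorted_list_of_set (content ` (addable M - {\<alpha>}))"

lemma addable_contents:
  assumes "young M" "\<alpha> \<in> addable M"
  shows "set (other_contents M \<alpha>) = content ` addable M - {content \<alpha>}"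
    and "distinct (content \<alpha> # other_contents M \<alpha>)"
    and "content ` addable M = set (content \<alpha> # other_contents M \<alpha>)"
proof -
  show s: "set (other_contents M \<alpha>) = content ` addable M - {content \<alpha>}"
    using content_inj_addable[OF assms(1)] finite_addable[OF assms(1)] assms(2)
    by (simp add: other_contents_def inj_on_image_set_diff[of content "addable M"])
  then show "distinct (content \<alpha> # other_contents M \<alpha>)"
    by (simp add: other_contents_def)
  show "content ` addable M = set (content \<alpha> # other_contents M \<alpha>)"
    using s assms(2) by auto
qed

lemma seminormal_idem_Suc:
  assumes "\<alpha> = the_inv_into D T (Suc m)" "M = D - {\<alpha>}"
  shows "seminormal_idem (Suc m) D T =
    scalar (1 / (\<Prod>a\<leftarrow>other_contents M \<alpha>. of_int (content \<alpha> - a))) *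
      (seminormal_idem m M T * jm_poly (Suc m) (other_contents M \<alpha>))"
  by (simp only: assms(2) assms(1)[symmetric] seminormal_idem.simps Let_def jucys_murphy_eq_jm
      scalar_commute jm_poly_def other_contents_def)

text \<open>
  The properties of \<open>E\<^sub>T\<close> that the induction over the size of the tableau passes on.  The last one is how
  the fact that \<open>E\<^sub>T\<close> is a polynomial in the Jucys--Murphy elements enters.
\<close>

definition weight_idempotent :: "nat \<Rightarrow> (nat \<Rightarrow> int) \<Rightarrow> complex group_algebra \<Rightarrow> bool" where
  "weight_idempotent n sigma E \<longleftrightarrow>
     (\<forall>i. 1 \<le> i \<and> i \<le> n \<longrightarrow> E * jm i i = scalar (of_int (sigma i)) * E) \<and>
     E * E = E \<and> star E = E \<and> in_sym n E \<and>
     (\<forall>X. (\<forall>i. X * jm i i = jm i i * X) \<longrightarrow> X * E = E * X)"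

lemma weight_idempotent_annihilator:
  assumes "young M" "standard_tableau m M T" "\<And>b. b \<in> M \<Longrightarrow> sigma (T b) = content b"
    and "\<alpha> \<in> addable M" and E: "weight_idempotent m sigma E"
  shows "E * jm_poly (Suc m) (content \<alpha> # other_contents M \<alpha>) = 0"
proof -
  obtain h :: "complex poly" where h: "\<And>u. not_int u \<Longrightarrow>
      u * gap_prod M u * poly h u = (\<Prod>a\<in>content ` addable M. u - of_int a)"
    using content_function_addable[OF assms(1)] by blast
  show ?thesis
  proof (rule characteristic_identity[where w = sigma and h = h])
    fix u :: complex assume "not_int u"
    then have "u * (\<Prod>i\<in>{1..<Suc m}. 1 - 1 / (u - of_int (sigma i))\<^sup>2) * poly h u =
        (\<Prod>a\<in>content ` addable M. u - of_int a)"
      using h gap_prod_tableau[OF assms(2,3), of u] by simp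
    also have "\<dots> = (\<Prod>a\<leftarrow>content \<alpha> # other_contents M \<alpha>. u - of_int a)"
      using addable_contents(2,3)[OF assms(1,4)]
      by (simp only: prod.distinct_set_conv_list)
    finally show "u * (\<Prod>i\<in>{1..<Suc m}. 1 - 1 / (u - of_int (sigma i))\<^sup>2) * poly h u =
      (\<Prod>a\<leftarrow>content \<alpha> # other_contents M \<alpha>. u - of_int a)" .
  next
    have "jm (Suc m) (Suc m) * E = E * jm (Suc m) (Suc m)"
      using E jm_commute unfolding weight_idempotent_def by blast
    then show "E * jm (Suc m) (Suc m) = jm (Suc m) (Suc m) * E" by simp
  qed (use E in \<open>auto simp: weight_idempotent_def\<close>)
qed

text \<open>
  The annihilating polynomial on \<open>E\<^sub>U\<close> is the polynomial in the definition of \<open>E\<^sub>T\<close> times \<open>x\<^sub>n - c\<close>; hence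
  \<open>E\<^sub>T x\<^sub>n = c E\<^sub>T\<close>.  Together with \<open>E\<^sub>T E\<^sub>U = E\<^sub>T\<close> and the normalization this gives \<open>E\<^sub>T\<^sup>2 = E\<^sub>T\<close>.
\<close>

lemma seminormal_weight_idempotent:
  assumes "young D" "standard_tableau n D T" "\<And>b. b \<in> D \<Longrightarrow> sigma (T b) = content b"
  shows "weight_idempotent n sigma (seminormal_idem n D T)"
  using assms
proof (induction n arbitrary: D)
  case 0
  then show ?case
    using star_scalar[of 1] by (auto simp: weight_idempotent_def in_sym_1)
next
  case (Suc m)
  define \<alpha> where "\<alpha> = the_inv_into D T (Suc m)"
  define M where "M = D - {\<alpha>}"
  define E where "E = seminormal_idem m M T"
  let ?as = "other_contents M \<alpha>"
  let ?Q = "jm_poly (Suc m) ?as :: complex group_algebra"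
  define s :: complex where "s = 1 / (\<Prod>a\<leftarrow>?as. of_int (content \<alpha> - a))"
  have F: "seminormal_idem (Suc m) D T = scalar s * (E * ?Q)"
    unfolding s_def E_def by (rule seminormal_idem_Suc[OF \<alpha>_def M_def])
  note rem = remove_largest_entry[OF Suc.prems(1,2), folded \<alpha>_def, folded M_def]
  have sM: "sigma (T b) = content b" if "b \<in> M" for b
    using Suc.prems(3) that by (simp add: M_def)
  have IH: "weight_idempotent m sigma E"
    unfolding E_def by (rule Suc.IH[OF rem(4,5)]) (use sM in auto)
  have s0: "s * (\<Prod>a\<leftarrow>?as. of_int (content \<alpha> - a)) = 1"
  proof -
    have "(\<Prod>a\<leftarrow>?as. of_int (content \<alpha> - a)) \<noteq> (0::complex)"
      using addable_contents(2)[OF rem(4,3)] by (auto simp: prod_list_zero_iff)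
    then show ?thesis by (simp add: s_def)
  qed
  have comm: "X * (scalar s * (E * ?Q)) = scalar s * (E * ?Q) * X"
    if "\<And>i. X * jm i i = jm i i * X" for X
  proof -
    have XE: "X * E = E * X" using IH that by (simp add: weight_idempotent_def)
    have XQ: "X * ?Q = ?Q * X" by (rule jm_poly_commute[OF that])
    have "X * (scalar s * (E * ?Q)) = scalar s * ((X * E) * ?Q)"
      by (simp only: scalar_left_commute[of X] mult.assoc)
    also have "\<dots> = scalar s * (E * (X * ?Q))" by (simp only: XE mult.assoc)
    also have "\<dots> = scalar s * (E * ?Q) * X" by (simp only: XQ mult.assoc)
    finally show ?thesis .
  qed
  have EQ: "E * ?Q = ?Q * E"
  proof (rule jm_poly_commute)
    have "jm (Suc m) (Suc m) * E = E * jm (Suc m) (Suc m)"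
      using IH jm_commute unfolding weight_idempotent_def by blast
    then show "E * jm (Suc m) (Suc m) = jm (Suc m) (Suc m) * E" by simp
  qed
  have weight: "scalar s * (E * ?Q) * jm i i = scalar (of_int (sigma i)) * (scalar s * (E * ?Q))"
    if "1 \<le> i" "i \<le> Suc m" for i
  proof (cases "i = Suc m")
    case True
    have "sigma i = content \<alpha>" using Suc.prems(3)[OF rem(1)] rem(2) True by simp
    moreover have "E * ?Q * jm (Suc m) (Suc m) = scalar (of_int (content \<alpha>)) * (E * ?Q)"
      using weight_idempotent_annihilator[OF rem(4,5) sM rem(3) IH]
      by (simp add: jm_poly_Cons' right_diff_distrib scalar_of_int[symmetric] scalar_commute[of ?Q]
          mult.assoc scalar_left_commute[of E])
    ultimately show ?thesis
      using True by (simp only: mult.assoc scalar_left_commute[of "scalar (of_int (content \<alpha>))"])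
  next
    case False
    have "E * ?Q * jm i i = E * jm i i * ?Q"
      by (simp only: mult.assoc jm_poly_commute[of "jm i i", OF jm_commute])
    also have "E * jm i i = scalar (of_int (sigma i)) * E"
      using IH that False by (simp add: weight_idempotent_def)
    finally show ?thesis
      by (simp only: mult.assoc scalar_left_commute[of "scalar (of_int (sigma i))"])
  qed
  have FE: "scalar s * (E * ?Q) * E = scalar s * (E * ?Q)"
    using IH EQ by (simp add: weight_idempotent_def mult.assoc flip: EQ) (simp flip: mult.assoc)
  have "scalar s * (E * ?Q) * (scalar s * (E * ?Q)) = scalar s * (scalar s * (E * ?Q) * E * ?Q)"
    by (simp only: mult.assoc scalar_left_commute[of "E * ?Q"] scalar_left_commute[of ?Q] scalar_left_commute[of E])
  also have "\<dots> = scalar s * (scalar s * (E * ?Q) * ?Q)" by (simp only: FE)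
  also have "scalar s * (E * ?Q) * ?Q =
      scalar (\<Prod>a\<leftarrow>?as. of_int (content \<alpha> - a)) * (scalar s * (E * ?Q))"
  proof (rule jm_poly_eigen)
    have "sigma (Suc m) = content \<alpha>" using Suc.prems(3)[OF rem(1)] rem(2) by simp
    then show "scalar s * (E * ?Q) * jm (Suc m) (Suc m) =
        scalar (of_int (content \<alpha>)) * (scalar s * (E * ?Q))"
      using weight[of "Suc m"] by simp
  qed
  also have "scalar s * \<dots> = scalar (s * (\<Prod>a\<leftarrow>?as. of_int (content \<alpha> - a))) * (scalar s * (E * ?Q))"
    by (simp only: scalar_mult mult.assoc)
  finally have idem: "scalar s * (E * ?Q) * (scalar s * (E * ?Q)) = scalar s * (E * ?Q)"
    by (simp only: s0 scalar_1 mult_1_left)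
  have cnj_s: "cnj s = s"
  proof -
    have "cnj (\<Prod>a\<leftarrow>bs. of_int (content \<alpha> - a)) = (\<Prod>a\<leftarrow>bs. of_int (content \<alpha> - a))" for bs
      by (induction bs) simp_all
    then show ?thesis by (simp add: s_def)
  qed
  have star: "star (scalar s * (E * ?Q)) = scalar s * (E * ?Q)"
  proof -
    have "star E = E" using IH by (simp add: weight_idempotent_def)
    then show ?thesis
      by (simp only: star_mult star_scalar cnj_s star_jm_poly scalar_commute[of "?Q * E"] EQ)
  qed
  have "in_sym (Suc m) (scalar s * (E * ?Q))"
    using IH in_sym_mono[of m E "Suc m"]
    by (intro in_sym_mult in_sym_scalar in_sym_jm_poly) (simp add: weight_idempotent_def)
  then show ?case
    unfolding F weight_idempotent_def using weight idem star comm by blast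
qed

lemma weight_idempotent_left:
  assumes "weight_idempotent n sigma E" "1 \<le> i" "i \<le> n"
  shows "jm i i * E = scalar (of_int (sigma i)) * E"
proof -
  have "star (E * jm i i) = star (scalar (of_int (sigma i)) * E)"
    using assms by (simp add: weight_idempotent_def)
  then show ?thesis
    using assms by (simp add: weight_idempotent_def star_mult star_jm star_scalar scalar_commute[of E])
qed


section \<open>Evaluation of rational functions\<close>

subsection \<open>The coefficient fields\<close>

instance fract :: ("{idom, ring_char_0}") field_char_0
proof
  show "inj (of_nat :: nat \<Rightarrow> 'a fract)"
    by (rule injI) (simp add: of_nat_fract eq_fract)
qed

lemma coefficient_hom_divide:
  fixes f :: "'k::field \<Rightarrow> 'l::field"
  assumes "coefficient_hom f"
  shows "f (a / b) = f a / f b"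
proof (cases "b = 0")
  case True
  then show ?thesis using coefficient_hom.hom_0[OF assms] by simp
next
  case False
  have "f b * f (inverse b) = 1"
    using False coefficient_hom.hom_mult[OF assms, of b "inverse b"] coefficient_hom.hom_1[OF assms]
    by simp
  then have "f b \<noteq> 0" "f (inverse b) = inverse (f b)"
    by (auto simp: inverse_unique)
  then show ?thesis
    using coefficient_hom.hom_mult[OF assms, of a "inverse b"] by (simp add: divide_inverse)
qed

interpretation R: coefficient_hom ratfun_of_cfield
  by unfold_locales (simp_all add: ratfun_of_cfield_def single_add mult_single flip: to_fract_add to_fract_mult)

interpretation C: coefficient_hom cfield_of_complex
  by unfold_locales (simp_all add: cfield_of_complex_def flip: to_fract_add to_fract_mult one_pCons)

definition ratfun_of_complex :: "complex \<Rightarrow> ratfun" where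
  "ratfun_of_complex z = ratfun_of_cfield (cfield_of_complex z)"

interpretation F: coefficient_hom ratfun_of_complex
  by unfold_locales (simp_all add: ratfun_of_complex_def R.hom_add C.hom_add R.hom_mult C.hom_mult)

lemma ext_ratfun_of_complex: "R.ext (C.ext X) = F.ext X"
  by (rule poly_mapping_eqI) (simp add: R.lookup_ext C.lookup_ext F.lookup_ext ratfun_of_complex_def)

text \<open>
  The parameter \<open>\<omega>\<close> is transcendental; this keeps the first product in \<open>\<Omega>\<close> regular.
\<close>

lemma omega_shift_nonzero: "of_int z + omega / 2 \<noteq> (0 :: cfield)"
proof
  assume "of_int z + omega / 2 = 0"
  then have "omega = of_int (- 2 * z)" by (simp add: field_simps eq_neg_iff_add_eq_0)
  also have "\<dots> = to_fract [:of_int (- 2 * z):]"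
    using C.hom_of_int[of "- 2 * z"] by (simp add: cfield_of_complex_def)
  finally show False unfolding omega_def to_fract_eq_iff by simp
qed

text \<open>
  The values of the variables after the first \<open>k\<close> evaluations.
\<close>

definition partial_val :: "(nat \<Rightarrow> int) \<Rightarrow> nat \<Rightarrow> nat \<Rightarrow> ratfun" where
  "partial_val sigma k i = (if i \<in> {1..k} then of_int (sigma i) else var i)"

text \<open>
  The polynomials behind \<open>partial_val\<close>; their coefficients show that denominators do not vanish.
\<close>

definition mpol_val :: "(nat \<Rightarrow> int) \<Rightarrow> nat \<Rightarrow> nat \<Rightarrow> mpol" where
  "mpol_val sigma k i = (if i \<in> {1..k} then Poly_Mapping.single 0 (of_int (sigma i))
     else Poly_Mapping.single (Poly_Mapping.single i 1) 1)"

lemma partial_val_eq: "partial_val sigma k i = to_fract (mpol_val sigma k i)"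
  using R.hom_of_int[of "sigma i"]
  by (simp add: partial_val_def mpol_val_def var_def ratfun_of_cfield_def)

lemma monomial_eq_iff: "Poly_Mapping.single i (1::nat) = Poly_Mapping.single j 1 \<longleftrightarrow> i = j"
  by (metis lookup_single_eq lookup_single_not_eq one_neq_zero)

lemma monomial_ne_0: "0 \<noteq> Poly_Mapping.single j (1::nat)"
  by (metis lookup_single_eq lookup_zero one_neq_zero)

text \<open>
  The constant coefficient is an integer plus \<open>\<omega>/2\<close>, whichever variables have been evaluated.
\<close>

lemma partial_val_sum_nonzero:
  "partial_val sigma k i + partial_val sigma k j + ratfun_of_cfield (omega / 2) \<noteq> 0"
proof
  assume "partial_val sigma k i + partial_val sigma k j + ratfun_of_cfield (omega / 2) = 0"
  then have *: "mpol_val sigma k i + mpol_val sigma k j + Poly_Mapping.single 0 (omega / 2) = 0"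
    unfolding partial_val_eq ratfun_of_cfield_def by (simp flip: to_fract_add)
  have "\<exists>z. Poly_Mapping.lookup (mpol_val sigma k l) 0 = of_int z" for l
    by (cases "l \<in> {1..k}") (auto simp: mpol_val_def lookup_single when_def simp del: single_of_int intro: exI[of _ 0])
  then obtain a b where "Poly_Mapping.lookup (mpol_val sigma k i) 0 = of_int a"
    "Poly_Mapping.lookup (mpol_val sigma k j) 0 = of_int b" by metis
  then have "of_int (a + b) + omega / 2 = 0"
    using arg_cong[OF *, of "\<lambda>p. Poly_Mapping.lookup p 0"] by (simp add: lookup_add)
  then show False using omega_shift_nonzero by blast
qed

text \<open>
  The variable \<open>v\<^sub>j\<close> is still present, and has coefficient \<open>-1\<close>.
\<close>

lemma partial_val_diff_nonzero:
  assumes "i < j" "k < j"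
  shows "partial_val sigma k i - partial_val sigma k j \<noteq> 0"
proof
  assume "partial_val sigma k i - partial_val sigma k j = 0"
  then have *: "mpol_val sigma k i = mpol_val sigma k j"
    unfolding partial_val_eq by simp
  have "Poly_Mapping.lookup (mpol_val sigma k i) (Poly_Mapping.single j 1) = 0"
    using assms by (simp add: mpol_val_def lookup_single when_def monomial_eq_iff monomial_ne_0
        del: single_of_int One_nat_def)
  moreover have "Poly_Mapping.lookup (mpol_val sigma k j) (Poly_Mapping.single j 1) = 1"
    using assms by (simp add: mpol_val_def)
  ultimately show False using * by simp
qed

lemma not_int_var: "not_int (var j)"
  unfolding not_int_def
proof
  fix z
  have "Poly_Mapping.single (Poly_Mapping.single j (1::nat)) (1::cfield) \<noteq> Poly_Mapping.single 0 (of_int z)"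
  proof
    assume "Poly_Mapping.single (Poly_Mapping.single j (1::nat)) (1::cfield) = Poly_Mapping.single 0 (of_int z)"
    from arg_cong[OF this, of "\<lambda>p. Poly_Mapping.lookup p (Poly_Mapping.single j 1)"]
    show False
      by (simp add: lookup_single when_def monomial_ne_0 del: single_of_int One_nat_def)
  qed
  then show "var j \<noteq> of_int z"
    using R.hom_of_int[of z] unfolding var_def ratfun_of_cfield_def by (metis to_fract_eq_iff)
qed

subsection \<open>Evaluation is a homomorphism on regular functions\<close>

lemma update_zero [simp]: "Poly_Mapping.update k 0 (0 :: nat \<Rightarrow>\<^sub>0 nat) = 0"
  by (rule poly_mapping_eqI) (simp add: lookup_update)

lemma subst_var_1 [simp]: "subst_var k c 1 = 1"
  using subst_var_single[of k c 0 1] by simp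

text \<open>
  From here on only closure properties are used: evaluation is a homomorphism on the local ring of rational
  functions regular at the given point.
\<close>

lemma evaluates_to_poly: "evaluates_to k c (to_fract P) (to_fract (subst_var k c P))"
  unfolding evaluates_to_def to_fract_def by (rule exI[of _ P], rule exI[of _ 1]) simp

lemma evaluates_to_const [intro]: "evaluates_to k c (ratfun_of_cfield d) (ratfun_of_cfield d)"
  using evaluates_to_poly[of k c "Poly_Mapping.single 0 d"]
  by (simp add: ratfun_of_cfield_def subst_var_single)

lemma evaluates_to_of_int [intro]: "evaluates_to k c (of_int z) (of_int z)"
  using evaluates_to_const[of k c "of_int z"] by (simp add: R.hom_of_int)

lemma evaluates_to_0 [intro]: "evaluates_to k c 0 0"
  and evaluates_to_1 [intro]: "evaluates_to k c 1 1"
  using evaluates_to_of_int[of k c 0] evaluates_to_of_int[of k c 1] by simp_all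

lemma evaluates_to_of_nat [intro]: "evaluates_to k c (of_nat z) (of_nat z)"
  using evaluates_to_of_int[of k c "int z"] by simp

lemma evaluates_to_var: "evaluates_to k c (var k) (ratfun_of_cfield c)"
proof -
  have "Poly_Mapping.update k 0 (Poly_Mapping.single k (1::nat)) = 0"
    by (rule poly_mapping_eqI) (simp add: lookup_update lookup_single when_def)
  then show ?thesis
    using evaluates_to_poly[of k c "Poly_Mapping.single (Poly_Mapping.single k 1) 1"]
    by (simp add: var_def ratfun_of_cfield_def subst_var_single)
qed

lemma evaluates_to_other_var:
  assumes "i \<noteq> k"
  shows "evaluates_to k c (var i) (var i)"
proof -
  have "Poly_Mapping.update k 0 (Poly_Mapping.single i (1::nat)) = Poly_Mapping.single i 1"
    using assms by (intro poly_mapping_eqI) (auto simp: lookup_update lookup_single when_def)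
  then show ?thesis
    using assms evaluates_to_poly[of k c "Poly_Mapping.single (Poly_Mapping.single i 1) 1"]
    by (simp add: var_def subst_var_single lookup_single)
qed

lemma evaluates_to_add:
  assumes "evaluates_to k c f g" "evaluates_to k c f' g'"
  shows "evaluates_to k c (f + f') (g + g')"
proof -
  obtain P Q where *: "subst_var k c Q \<noteq> 0" "f = Fract P Q"
      "g = Fract (subst_var k c P) (subst_var k c Q)"
    using assms(1) by (auto simp: evaluates_to_def)
  obtain P' Q' where **: "subst_var k c Q' \<noteq> 0" "f' = Fract P' Q'"
      "g' = Fract (subst_var k c P') (subst_var k c Q')"
    using assms(2) by (auto simp: evaluates_to_def)
  have "Q \<noteq> 0" "Q' \<noteq> 0" using * ** by auto
  then show ?thesis
    unfolding evaluates_to_def using * **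
    by (intro exI[of _ "P * Q' + P' * Q"] exI[of _ "Q * Q'"]) (simp add: subst_var_add subst_var_mult)
qed

lemma evaluates_to_mult:
  assumes "evaluates_to k c f g" "evaluates_to k c f' g'"
  shows "evaluates_to k c (f * f') (g * g')"
proof -
  obtain P Q where *: "subst_var k c Q \<noteq> 0" "f = Fract P Q"
      "g = Fract (subst_var k c P) (subst_var k c Q)"
    using assms(1) by (auto simp: evaluates_to_def)
  obtain P' Q' where **: "subst_var k c Q' \<noteq> 0" "f' = Fract P' Q'"
      "g' = Fract (subst_var k c P') (subst_var k c Q')"
    using assms(2) by (auto simp: evaluates_to_def)
  show ?thesis
    unfolding evaluates_to_def using * **
    by (intro exI[of _ "P * P'"] exI[of _ "Q * Q'"]) (simp add: subst_var_mult)
qed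

lemma evaluates_to_uminus: "evaluates_to k c f g \<Longrightarrow> evaluates_to k c (- f) (- g)"
  using evaluates_to_mult[OF evaluates_to_of_int[of k c "-1"]] by fastforce

lemma evaluates_to_diff:
  "evaluates_to k c f g \<Longrightarrow> evaluates_to k c f' g' \<Longrightarrow> evaluates_to k c (f - f') (g - g')"
  using evaluates_to_add[OF _ evaluates_to_uminus] by fastforce

lemma evaluates_to_inverse:
  assumes "evaluates_to k c f g" "g \<noteq> 0"
  shows "evaluates_to k c (inverse f) (inverse g)"
proof -
  obtain P Q where *: "subst_var k c Q \<noteq> 0" "f = Fract P Q"
      "g = Fract (subst_var k c P) (subst_var k c Q)"
    using assms(1) by (auto simp: evaluates_to_def)
  have "subst_var k c P \<noteq> 0"
    using assms(2) * by (auto simp: fract_collapse)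
  then show ?thesis
    unfolding evaluates_to_def using * by (intro exI[of _ Q] exI[of _ P]) simp
qed

lemma evaluates_to_divide:
  "evaluates_to k c f g \<Longrightarrow> evaluates_to k c f' g' \<Longrightarrow> g' \<noteq> 0 \<Longrightarrow> evaluates_to k c (f / f') (g / g')"
  unfolding divide_inverse by (intro evaluates_to_mult evaluates_to_inverse)

lemma evaluates_to_power:
  "evaluates_to k c f g \<Longrightarrow> evaluates_to k c (f ^ m) (g ^ m)"
  by (induction m) (auto intro: evaluates_to_mult)

lemma evaluates_to_prod:
  "(\<And>b. b \<in> A \<Longrightarrow> evaluates_to k c (f b) (g b)) \<Longrightarrow> evaluates_to k c (prod f A) (prod g A)"
  by (induction A rule: infinite_finite_induct) (auto intro: evaluates_to_mult)

lemma evaluates_to_prod_list: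
  "(\<And>b. b \<in> set bs \<Longrightarrow> evaluates_to k c (f b) (g b)) \<Longrightarrow>
    evaluates_to k c (prod_list (map f bs)) (prod_list (map g bs))"
  by (induction bs) (auto intro: evaluates_to_mult)

lemma evaluates_to_partial_val:
  "evaluates_to (Suc k) (of_int (sigma (Suc k))) (partial_val sigma k i) (partial_val sigma (Suc k) i)"
proof (cases "i = Suc k")
  case True
  then show ?thesis
    using evaluates_to_var[of "Suc k" "of_int (sigma (Suc k))"] by (simp add: partial_val_def R.hom_of_int)
next
  case False
  then show ?thesis
    using evaluates_to_other_var[OF False] by (auto simp: partial_val_def)
qed

lemma ga_evaluates_to_add:
  "ga_evaluates_to k c X Y \<Longrightarrow> ga_evaluates_to k c X' Y' \<Longrightarrow> ga_evaluates_to k c (X + X') (Y + Y')"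
  by (simp add: ga_evaluates_to_def lookup_add evaluates_to_add)

lemma ga_evaluates_to_diff:
  "ga_evaluates_to k c X Y \<Longrightarrow> ga_evaluates_to k c X' Y' \<Longrightarrow> ga_evaluates_to k c (X - X') (Y - Y')"
  by (simp add: ga_evaluates_to_def lookup_minus evaluates_to_diff)

lemma ga_evaluates_to_single:
  "evaluates_to k c f g \<Longrightarrow> ga_evaluates_to k c (Poly_Mapping.single p f) (Poly_Mapping.single p g)"
  by (auto simp: ga_evaluates_to_def lookup_single when_def)

lemma ga_evaluates_to_scalar:
  "evaluates_to k c f g \<Longrightarrow> ga_evaluates_to k c (scalar f) (scalar g)"
  by (simp add: scalar_def ga_evaluates_to_single)

lemma ga_evaluates_to_transp: "ga_evaluates_to k c (transp i j) (transp i j)"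
  unfolding transp_def by (rule ga_evaluates_to_single) (rule evaluates_to_1)

lemma ga_evaluates_to_1: "ga_evaluates_to k c 1 1"
  using ga_evaluates_to_scalar[OF evaluates_to_1] by simp

lemma ga_evaluates_to_0: "ga_evaluates_to k c 0 0"
  using ga_evaluates_to_scalar[OF evaluates_to_0] by simp

lemma ga_evaluates_to_const: "ga_evaluates_to k c (R.ext X) (R.ext X)"
  by (auto simp: ga_evaluates_to_def R.lookup_ext)

lemma ga_evaluates_to_sum:
  "(\<And>a. a \<in> A \<Longrightarrow> ga_evaluates_to k c (X a) (Y a)) \<Longrightarrow> ga_evaluates_to k c (sum X A) (sum Y A)"
  by (induction A rule: infinite_finite_induct) (auto intro: ga_evaluates_to_add ga_evaluates_to_0)

lemma sum_singles_superset:
  assumes "finite A" "Poly_Mapping.keys P \<subseteq> A"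
  shows "P = (\<Sum>m\<in>A. Poly_Mapping.single m (Poly_Mapping.lookup P m))"
  using assms by (subst sum_singles) (auto intro!: sum.mono_neutral_left simp: in_keys_iff)

lemma ga_evaluates_to_mult:
  assumes "ga_evaluates_to k c X Y" "ga_evaluates_to k c X' Y'"
  shows "ga_evaluates_to k c (X * X') (Y * Y')"
proof -
  let ?A = "Poly_Mapping.keys X \<union> Poly_Mapping.keys Y"
  let ?B = "Poly_Mapping.keys X' \<union> Poly_Mapping.keys Y'"
  let ?S = "\<lambda>A Z. \<Sum>m\<in>A. Poly_Mapping.single m (Poly_Mapping.lookup Z m)"
  have "ga_evaluates_to k c (?S ?A X * ?S ?B X') (?S ?A Y * ?S ?B Y')"
    unfolding sum_product mult_single using assms
    by (intro ga_evaluates_to_sum ga_evaluates_to_single evaluates_to_mult)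
      (simp_all add: ga_evaluates_to_def)
  then show ?thesis
    using sum_singles_superset[of ?A X] sum_singles_superset[of ?A Y]
      sum_singles_superset[of ?B X'] sum_singles_superset[of ?B Y'] by simp
qed

lemma ga_evaluates_to_prod_list:
  "(\<And>b. b \<in> set bs \<Longrightarrow> ga_evaluates_to k c (f b) (g b)) \<Longrightarrow>
    ga_evaluates_to k c (prod_list (map f bs)) (prod_list (map g bs))"
  by (induction bs) (auto intro: ga_evaluates_to_mult ga_evaluates_to_1)

lemma ga_evaluates_to_jm: "ga_evaluates_to k c (jm m n) (jm m n)"
  unfolding jm_def by (intro ga_evaluates_to_sum ga_evaluates_to_transp)

lemma ga_evaluates_to_jm_poly: "ga_evaluates_to k c (jm_poly n as) (jm_poly n as)"
  unfolding jm_poly_def scalar_of_int[symmetric]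
  by (intro ga_evaluates_to_prod_list ga_evaluates_to_diff ga_evaluates_to_jm
      ga_evaluates_to_scalar evaluates_to_of_int)

lemma ga_evaluates_to_jm_quot:
  assumes "evaluates_to k c u v"
  shows "ga_evaluates_to k c (jm_quot n as u) (jm_quot n as v)"
  by (induction as)
    (auto intro!: ga_evaluates_to_0 ga_evaluates_to_add ga_evaluates_to_mult ga_evaluates_to_jm_poly
      ga_evaluates_to_scalar evaluates_to_diff assms)

lemma consecutive_evaluation_chain:
  assumes "\<And>k. m \<le> k \<Longrightarrow> k < n \<Longrightarrow> ga_evaluates_to (Suc k) (c (Suc k)) (Z k) (Z (Suc k))" "m \<le> n"
  shows "consecutive_evaluation (map (\<lambda>k. (k, c k)) [Suc m..<Suc n]) (Z m) (Z n)"
  using assms(2,1)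
proof (induction m rule: inc_induct)
  case base
  then show ?case by simp
next
  case (step m)
  have "[Suc m..<Suc n] = Suc m # [Suc (Suc m)..<Suc n]"
    using step.hyps by (simp add: upt_conv_Cons)
  then show ?case using step by (auto simp del: upt_Suc)
qed

section \<open>Reordering the lexicographic product\<close>

definition column_prod :: "(nat \<times> nat \<Rightarrow> 'a::monoid_mult) \<Rightarrow> nat \<Rightarrow> 'a" where
  "column_prod f j = prod_list (map (\<lambda>i. f (i, j)) [1..<j])"

lemma prod_list_commute:
  fixes x :: "'a::monoid_mult"
  assumes "\<And>y. y \<in> set ys \<Longrightarrow> x * y = y * x"
  shows "x * prod_list ys = prod_list ys * x"
  using assms
proof (induction ys)
  case (Cons y ys)
  have "x * (y * prod_list ys) = y * (x * prod_list ys)"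
    using Cons.prems[of y] by (simp flip: mult.assoc)
  then show ?case using Cons by (simp add: mult.assoc)
qed simp

text \<open>
  Induction on \<open>n\<close>.  The lexicographic product is a product of rows, and passing from \<open>n\<close> to \<open>n + 1\<close> appends the
  factor \<open>f (i, n + 1)\<close> to row \<open>i\<close>.  It can be moved to the right past the rows \<open>i' > i\<close>, whose factors involve
  only the points \<open>i', \<dots>, n\<close>.
\<close>

lemma lex_product_by_columns:
  fixes f :: "nat \<times> nat \<Rightarrow> 'a::monoid_mult"
  assumes comm: "\<And>i j k l. i \<noteq> k \<Longrightarrow> i \<noteq> l \<Longrightarrow> j \<noteq> k \<Longrightarrow> j \<noteq> l \<Longrightarrow> f (i, j) * f (k, l) = f (k, l) * f (i, j)"
  shows "prod_list (map f (lex_pairs n)) = prod_list (map (column_prod f) [1..<n+1])"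
proof -
  define r where "r n i = prod_list (map (\<lambda>j. f (i, j)) [i+1..<n+1])" for n i
  have lex: "prod_list (map f (lex_pairs n)) = prod_list (map (r n) [1..<n+1])" for n
  proof -
    have "prod_list (map f (concat (map (\<lambda>i. map (Pair i) [i+1..<n+1]) is))) = prod_list (map (r n) is)" for "is"
      by (induction "is") (simp_all add: r_def o_def del: upt_Suc)
    then show ?thesis
      by (simp add: lex_pairs_def Let_def del: upt_Suc) 
  qed
  have merge: "prod_list (map (\<lambda>i. r n i * f (i, Suc n)) [1..<m+1]) =
      prod_list (map (r n) [1..<m+1]) * prod_list (map (\<lambda>i. f (i, Suc n)) [1..<m+1])" if "m \<le> n" for m n
    using that
  proof (induction m)
    case (Suc m)
    let ?R = "prod_list (map (r n) [1..<m+1])" and ?F = "prod_list (map (\<lambda>i. f (i, Suc n)) [1..<m+1])"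
    have "r n (m+1) * ?F = ?F * r n (m+1)"
    proof (rule prod_list_commute)
      fix y assume "y \<in> set (map (\<lambda>i. f (i, Suc n)) [1..<m+1])"
      then obtain i where i: "i < m + 1" "y = f (i, Suc n)"
        by (auto simp del: upt_Suc)
      have "y * r n (m+1) = r n (m+1) * y"
        unfolding r_def
        by (rule prod_list_commute) (use i Suc.prems in \<open>auto intro!: comm\<close>)
      then show "r n (m+1) * y = y * r n (m+1)" by simp
    qed
    note swap = this
    have "?R * ?F * (r n (m+1) * f (m+1, Suc n)) = ?R * ((?F * r n (m+1)) * f (m+1, Suc n))"
      by (simp only: mult.assoc)
    also have "\<dots> = ?R * r n (m+1) * (?F * f (m+1, Suc n))"
      by (simp only: swap[symmetric] mult.assoc)
    finally have "?R * ?F * (r n (m+1) * f (m+1, Suc n)) = ?R * r n (m+1) * (?F * f (m+1, Suc n))" .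
    then show ?case using Suc by (simp add: mult.assoc)
  qed simp
  have "prod_list (map (r n) [1..<n+1]) = prod_list (map (column_prod f) [1..<n+1])"
  proof (induction n)
    case (Suc n)
    have "prod_list (map (r (Suc n)) [1..<Suc n+1]) = prod_list (map (r (Suc n)) [1..<n+1])"
      by (simp add: r_def)
    also have "map (r (Suc n)) [1..<n+1] = map (\<lambda>i. r n i * f (i, Suc n)) [1..<n+1]"
      by (auto simp: r_def)
    also have "prod_list \<dots> = prod_list (map (r n) [1..<n+1]) * prod_list (map (\<lambda>i. f (i, Suc n)) [1..<n+1])"
      by (rule merge) simp
    finally show ?case using Suc by (simp add: column_prod_def)
  qed simp
  then show ?thesis using lex by simp
qed


section \<open>The consecutive evaluations\<close>

lemma ratfun_of_cfield_eq_0_iff: "ratfun_of_cfield x = 0 \<longleftrightarrow> x = 0"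
  unfolding ratfun_of_cfield_def to_fract_eq_0_iff by (metis lookup_single_eq lookup_zero single_zero)

lemma omega_shift_nonzero_ratfun: "of_int z + ratfun_of_cfield (omega / 2) \<noteq> 0"
  using omega_shift_nonzero[of z] ratfun_of_cfield_eq_0_iff[of "of_int z + omega / 2"]
  by (simp add: R.hom_add R.hom_of_int)

definition plus_factor :: "(nat \<Rightarrow> ratfun) \<Rightarrow> nat \<times> nat \<Rightarrow> ratfun group_algebra" where
  "plus_factor w = (\<lambda>(i, j). 1 + scalar (1 / (w i + w j + ratfun_of_cfield (omega / 2))) * transp i j)"

definition minus_factor :: "(nat \<Rightarrow> ratfun) \<Rightarrow> nat \<times> nat \<Rightarrow> ratfun group_algebra" where
  "minus_factor w = (\<lambda>(i, j). 1 - scalar (1 / (w i - w j)) * transp i j)"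

lemma factor_commute:
  fixes a b :: "'k::comm_ring_1"
  assumes "i \<noteq> k" "i \<noteq> l" "j \<noteq> k" "j \<noteq> l"
  shows "(1 + scalar a * transp i j) * (1 + scalar b * transp k l) =
    (1 + scalar b * transp k l) * (1 + scalar a * transp i j)"
proof -
  have "scalar a * transp i j * (scalar b * transp k l) = scalar b * transp k l * (scalar a * transp i j)"
    using transp_disjoint[where ?'k = 'k, OF assms]
    by (simp add: mult.assoc transp_scalar_commute scalar_left_commute[of "scalar a" b])
  then show ?thesis by (simp add: distrib_left distrib_right add_ac)
qed

lemma plus_factor_columns:
  "prod_list (map (plus_factor w) (lex_pairs n)) =
    prod_list (map (column_prod (plus_factor w)) [1..<n+1])"
  by (rule lex_product_by_columns) (simp add: plus_factor_def factor_commute)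

lemma minus_factor_columns:
  "prod_list (map (minus_factor w) (lex_pairs n)) =
    prod_list (map (column_prod (minus_factor w)) [1..<n+1])"
proof (rule lex_product_by_columns)
  fix i j k l :: nat assume *: "i \<noteq> k" "i \<noteq> l" "j \<noteq> k" "j \<noteq> l"
  show "minus_factor w (i, j) * minus_factor w (k, l) = minus_factor w (k, l) * minus_factor w (i, j)"
    using factor_commute[OF *, of "- (1 / (w i - w j))" "- (1 / (w k - w l))"]
    by (simp add: minus_factor_def scalar_uminus)
qed

text \<open>
  The columns act on \<open>E\<close> from the last one to the first, each one by a scalar according to
  \<open>product_times_weight\<close> with \<open>u = \<sigma>\<^sub>j + \<omega>/2\<close>.
\<close>

lemma plus_factor_product_times_weight:
  fixes E :: "ratfun group_algebra"
  assumes "\<And>i. 1 \<le> i \<Longrightarrow> i \<le> n \<Longrightarrow> jm i i * E = scalar (of_int (sigma i)) * E"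
  shows "prod_list (map (plus_factor (\<lambda>i. of_int (sigma i))) (lex_pairs n)) * E =
    scalar (\<Prod>j\<in>{1..n}. (2 * of_int (sigma j) + ratfun_of_cfield (omega / 2)) /
      (of_int (sigma j) + ratfun_of_cfield (omega / 2))) * E"
proof -
  define w where "w i = (of_int (sigma i) :: ratfun)" for i
  define u where "u j = w j + ratfun_of_cfield (omega / 2)" for j
  have u: "u j \<noteq> 0" for j
    unfolding u_def w_def by (rule omega_shift_nonzero_ratfun)
  have wu: "w i + u j \<noteq> 0" for i j
    using omega_shift_nonzero_ratfun[of "sigma i + sigma j"] by (simp add: u_def w_def add.assoc)
  have col: "column_prod (plus_factor w) j * E = scalar ((u j + w j) / u j) * E" if "1 \<le> j" "j \<le> n" for j
  proof (rule scalar_cancel[OF _ u])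
    have "scalar (u j) * (column_prod (plus_factor w) j * E) = scalar (u j) * E + jm j j * E"
      using product_times_weight[of j E w "u j" j] assms that wu
      by (simp add: column_prod_def plus_factor_def u_def w_def add.assoc)
    also have "jm j j * E = scalar (w j) * E" using assms[OF that] by (simp add: w_def)
    finally show "scalar (u j) * (column_prod (plus_factor w) j * E) =
        scalar (u j) * (scalar ((u j + w j) / u j) * E)"
      using u[of j] by (simp add: scalar_add distrib_right flip: mult.assoc scalar_mult)
  qed
  have "prod_list (map (column_prod (plus_factor w)) [1..<m+1]) * E =
      scalar (\<Prod>j\<in>{1..m}. (u j + w j) / u j) * E" if "m \<le> n" for m
    using that
  proof (induction m)
    case (Suc m)
    let ?P = "prod_list (map (column_prod (plus_factor w)) [1..<m+1])"
    have "?P * (column_prod (plus_factor w) (Suc m) * E) = scalar ((u (Suc m) + w (Suc m)) / u (Suc m)) * (?P * E)"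
      using Suc.prems by (simp only: col scalar_left_commute[of ?P])
    then have "prod_list (map (column_prod (plus_factor w)) [1..<Suc m+1]) * E =
        scalar ((u (Suc m) + w (Suc m)) / u (Suc m)) * (scalar (\<Prod>j\<in>{1..m}. (u j + w j) / u j) * E)"
      using Suc by (simp add: mult.assoc)
    then show ?case
      by (simp add: scalar_mult[symmetric] mult.commute flip: mult.assoc)
  qed simp
  then show ?thesis
    unfolding plus_factor_columns w_def[symmetric]
    by (simp add: u_def w_def add_ac)
qed

lemma (in added_box) evaluates_to_cofactor:
  assumes "evaluates_to k d u (of_int (content (p, q)))"
  shows "evaluates_to k d (cofactor u) (cofactor (of_int (content (p, q))))"
proof -
  have gap: "evaluates_to k d (gap_prod B u) (gap_prod B (of_int (content (p, q))))"
    if "B \<subseteq> right_part \<union> lower_part" for B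
    unfolding gap_prod_def
  proof (intro evaluates_to_prod evaluates_to_diff evaluates_to_1 evaluates_to_divide evaluates_to_power
      evaluates_to_of_int assms)
    fix b assume "b \<in> B"
    then have "content (p, q) \<noteq> content b" using content_right_lower[of b] that by auto
    then show "(of_int (content (p, q)) - of_int (content b))\<^sup>2 \<noteq> (0 :: ratfun)"
      by (simp del: content.simps)
  qed
  show ?thesis
    unfolding cofactor_def
    by (intro evaluates_to_mult evaluates_to_divide evaluates_to_diff evaluates_to_add evaluates_to_power
        evaluates_to_of_int evaluates_to_of_nat evaluates_to_1 assms gap) auto
qed

text \<open>
  A standard tableau together with its content vector.  The subtableaux of the entries up to \<open>k\<close> are the shapes that
  appear after \<open>k\<close> evaluations.
\<close>

locale tableau =
  fixes n :: nat and D :: "box set" and T :: "box \<Rightarrow> nat" and sigma :: "nat \<Rightarrow> int"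
  assumes young: "young D" and standard: "standard_tableau n D T"
    and sigma: "b \<in> D \<Longrightarrow> sigma (T b) = content b"
begin

definition subdiagram :: "nat \<Rightarrow> box set" where
  "subdiagram k = {b \<in> D. T b \<le> k}"

lemma subdiagram_n: "subdiagram n = D"
  using standard by (auto simp: subdiagram_def standard_tableau_def bij_betw_def)

lemma subdiagram_Suc_remove:
  assumes "standard_tableau (Suc k) (subdiagram (Suc k)) T" "young (subdiagram (Suc k))"
  shows "subdiagram (Suc k) - {the_inv_into (subdiagram (Suc k)) T (Suc k)} = subdiagram k"
proof -
  let ?\<alpha> = "the_inv_into (subdiagram (Suc k)) T (Suc k)"
  note rem = remove_largest_entry[OF assms(2,1)]
  have "inj_on T (subdiagram (Suc k))" using assms(1) by (auto simp: standard_tableau_def bij_betw_def)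
  then have "b = ?\<alpha>" if "b \<in> subdiagram (Suc k)" "T b = Suc k" for b
    by (rule inj_onD) (use that rem(1,2) in auto)
  then show ?thesis using rem(2) by (force simp: subdiagram_def le_Suc_eq)
qed

lemma subdiagram_standard:
  assumes "k \<le> n"
  shows "young (subdiagram k) \<and> standard_tableau k (subdiagram k) T"
  using assms
proof (induction k rule: inc_induct)
  case base
  then show ?case by (simp add: subdiagram_n young standard)
next
  case (step k)
  then show ?case
    using remove_largest_entry(4,5)[of "subdiagram (Suc k)" k T] subdiagram_Suc_remove[of k] by simp
qed

text \<open>
  What the first \<open>k\<close> columns of the second product become after \<open>k\<close> evaluations.
\<close>

definition fused :: "nat \<Rightarrow> ratfun group_algebra" where
  "fused k = scalar (of_nat (hook_product (subdiagram k))) * F.ext (seminormal_idem k (subdiagram k) T)"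

text \<open>
  By \<open>weight_times_column_regular\<close> the left-hand side is a product of functions regular at
  \<open>v\<^sub>k\<^sub>+\<^sub>1 = c\<close>, so it can be evaluated factor by factor.  The summand with the factor \<open>v\<^sub>k\<^sub>+\<^sub>1 - c\<close> disappears, and
  \<open>cofactor_at_content\<close> supplies the quotient of the hook products.
\<close>

lemma fusion_step:
  assumes "k < n"
  shows "ga_evaluates_to (Suc k) (of_int (sigma (Suc k)))
    (fused k * column_prod (minus_factor (partial_val sigma k)) (Suc k)) (fused (Suc k))"
proof -
  define M where "M = subdiagram k"
  define \<alpha> where "\<alpha> = the_inv_into (subdiagram (Suc k)) T (Suc k)"
  obtain p q where \<alpha>_eq: "\<alpha> = (p, q)" by (cases \<alpha>)
  define c where "c = content \<alpha>"
  define as where "as = other_contents M \<alpha>"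
  define E where "E = seminormal_idem k M T"
  define E' where "E' = F.ext E"
  define u where "u = var (Suc k)"
  have stSuc: "young (subdiagram (Suc k))" "standard_tableau (Suc k) (subdiagram (Suc k)) T"
    using subdiagram_standard[of "Suc k"] assms by auto
  have M: "M = subdiagram (Suc k) - {\<alpha>}"
    using subdiagram_Suc_remove[OF stSuc(2,1)] by (simp add: M_def \<alpha>_def)
  note rem = remove_largest_entry[OF stSuc, folded \<alpha>_def, folded M]
  have insert: "subdiagram (Suc k) = insert \<alpha> M" using rem(1) M by auto
  have sigmaM: "sigma (T b) = content b" if "b \<in> M" for b
    using that sigma by (simp add: M_def subdiagram_def)
  have sigma_c: "sigma (Suc k) = c"
    using rem(1,2) sigma[of \<alpha>] by (simp add: subdiagram_def c_def)
  have wE: "weight_idempotent k sigma E"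
    unfolding E_def by (rule seminormal_weight_idempotent[OF rem(4,5)]) (rule sigmaM)
  have weight: "E' * jm i i = scalar (of_int (sigma i)) * E'" if "1 \<le> i" "i < Suc k" for i
  proof -
    have "F.ext (E * jm i i) = F.ext (scalar (of_int (sigma i)) * E)"
      using wE that by (simp add: weight_idempotent_def)
    then show ?thesis
      by (simp add: E'_def F.ext_mult F.ext_scalar F.hom_of_int F.ext_sum F.ext_transp jm_def)
  qed
  have ext_poly: "F.ext (jm_poly m bs) = jm_poly m bs" for m bs
    by (simp add: jm_poly_def F.ext_prod_list o_def F.ext_diff jm_def F.ext_sum F.ext_transp
        F.ext_scalar F.hom_of_int flip: scalar_of_int)
  have "E * jm_poly (Suc k) (c # as) = 0"
    unfolding c_def as_def
    by (rule weight_idempotent_annihilator[OF rem(4,5) _ rem(3) wE]) (rule sigmaM)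
  then have zero: "E' * jm_poly (Suc k) (c # as) = 0"
    using F.ext_mult[of E "jm_poly (Suc k) (c # as)"] by (simp add: E'_def ext_poly)
  interpret B: added_box M p q
    using rem(3,4) by unfold_locales (simp_all add: \<alpha>_eq)
  have c_eq: "c = content (p, q)" by (simp only: c_def \<alpha>_eq)
  have dist: "distinct (c # as)"
    unfolding c_def as_def by (rule addable_contents(2)[OF rem(4,3)])
  have nu: "not_int u" unfolding u_def by (rule not_int_var)
  then have u_ne: "u \<noteq> of_int z" "of_int z \<noteq> u" for z by (auto simp: not_int_def)
  let ?g = "\<lambda>v::ratfun. \<Prod>a\<leftarrow>as. v - of_int a"
  have f: "u * (\<Prod>i\<in>{1..<Suc k}. 1 - 1 / (u - of_int (sigma i))\<^sup>2) = (u - of_int c) * B.cofactor u"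
    using gap_prod_tableau[OF rem(5) sigmaM, of u] B.gap_prod_cofactor[OF nu] by (simp only: c_eq)
  have "column_prod (minus_factor (partial_val sigma k)) (Suc k) =
      prod_list (map (\<lambda>i. 1 - scalar (1 / (of_int (sigma i) - u)) * transp i (Suc k)) [1..<Suc k])"
    unfolding column_prod_def
    by (intro arg_cong[of _ _ prod_list] map_cong) (auto simp: minus_factor_def partial_val_def u_def)
  also have "E' * \<dots> = scalar (B.cofactor u / ?g u) *
      (E' * jm_poly (Suc k) as + scalar (u - of_int c) * (E' * jm_quot (Suc k) as u))"
    by (rule weight_times_column_regular[OF weight _ zero f])
      (use u_ne in \<open>auto simp: prod_list_zero_iff\<close>)
  finally have before: "fused k * column_prod (minus_factor (partial_val sigma k)) (Suc k) =
      scalar (of_nat (hook_product M)) * (scalar (B.cofactor u / ?g u) *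
      (E' * jm_poly (Suc k) as + scalar (u - of_int c) * (E' * jm_quot (Suc k) as u)))"
    by (simp only: fused_def M_def[symmetric] E_def[symmetric] E'_def[symmetric] mult.assoc)
  have gc: "?g (of_int c) \<noteq> 0"
    using dist by (auto simp: prod_list_zero_iff)
  have ev_u: "evaluates_to (Suc k) (of_int (sigma (Suc k))) u (of_int c)"
    using evaluates_to_var[of "Suc k" "of_int (sigma (Suc k))"] by (simp add: u_def sigma_c R.hom_of_int)
  have ev_E: "ga_evaluates_to (Suc k) (of_int (sigma (Suc k))) E' E'"
    unfolding E'_def ext_ratfun_of_complex[symmetric] by (rule ga_evaluates_to_const)
  have ev: "ga_evaluates_to (Suc k) (of_int (sigma (Suc k)))
     (scalar (of_nat (hook_product M)) * (scalar (B.cofactor u / ?g u) *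
      (E' * jm_poly (Suc k) as + scalar (u - of_int c) * (E' * jm_quot (Suc k) as u))))
     (scalar (of_nat (hook_product M)) * (scalar (B.cofactor (of_int c) / ?g (of_int c)) *
      (E' * jm_poly (Suc k) as + scalar (of_int c - of_int c) * (E' * jm_quot (Suc k) as (of_int c)))))"
    by (intro ga_evaluates_to_mult ga_evaluates_to_add ga_evaluates_to_scalar ga_evaluates_to_jm_poly
        ga_evaluates_to_jm_quot evaluates_to_divide evaluates_to_prod_list evaluates_to_diff
        evaluates_to_of_int evaluates_to_of_nat ev_u ev_E gc
        B.evaluates_to_cofactor[folded c_eq])
  have "fused (Suc k) = scalar (of_nat (hook_product (subdiagram (Suc k)))) *
      (scalar (1 / ?g (of_int c)) * (E' * jm_poly (Suc k) as))"
  proof -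
    have "ratfun_of_complex (1 / (\<Prod>a\<leftarrow>bs. of_int (c - a))) = 1 / (\<Prod>a\<leftarrow>bs. of_int c - of_int a)" for bs
    proof -
      have "ratfun_of_complex (\<Prod>a\<leftarrow>bs. of_int (c - a)) = (\<Prod>a\<leftarrow>bs. of_int c - of_int a)"
        by (induction bs) (simp_all add: F.hom_mult F.hom_diff F.hom_of_int)
      then show ?thesis
        using coefficient_hom_divide[OF F.coefficient_hom_axioms] by simp
    qed
    moreover have "seminormal_idem (Suc k) (subdiagram (Suc k)) T =
        scalar (1 / (\<Prod>a\<leftarrow>as. of_int (c - a))) * (E * jm_poly (Suc k) as)"
      unfolding E_def c_def as_def by (rule seminormal_idem_Suc[OF \<alpha>_def M])
    ultimately show ?thesis
      by (simp add: fused_def F.ext_mult F.ext_scalar ext_poly E'_def)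
  qed
  also have "\<dots> = scalar (of_nat (hook_product M)) * (scalar (B.cofactor (of_int c) / ?g (of_int c)) *
      (E' * jm_poly (Suc k) as))"
  proof -
    have "hook_product M \<noteq> 0"
      using B.hook_length_pos B.young young_finite
      by (simp add: hook_product_def del: hook_length.simps)
    then have "of_nat (hook_product (subdiagram (Suc k))) * (1 / ?g (of_int c)) =
        of_nat (hook_product M) * (B.cofactor (of_int c) / ?g (of_int c))"
      using B.cofactor_at_content[where ?'k = ratfun] by (simp add: insert \<alpha>_eq c_eq del: content.simps)
    then show ?thesis by (simp only: mult.assoc[symmetric] scalar_mult[symmetric])
  qed
  finally have after: "fused (Suc k) = scalar (of_nat (hook_product M)) *
      (scalar (B.cofactor (of_int c) / ?g (of_int c)) *
      (E' * jm_poly (Suc k) as + scalar (of_int c - of_int c) * (E' * jm_quot (Suc k) as (of_int c))))"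
    by simp
  show ?thesis unfolding before after by (rule ev)
qed

text \<open>
  The value of \<open>\<Omega>\<close> after \<open>k\<close> evaluations.
\<close>

definition stage :: "nat \<Rightarrow> ratfun group_algebra" where
  "stage k = prod_list (map (plus_factor (partial_val sigma k)) (lex_pairs n)) *
    (fused k * prod_list (map (column_prod (minus_factor (partial_val sigma k))) [Suc k..<Suc n]))"

lemma stage_step:
  assumes "k < n"
  shows "ga_evaluates_to (Suc k) (of_int (sigma (Suc k))) (stage k) (stage (Suc k))"
proof -
  let ?ev = "ga_evaluates_to (Suc k) (of_int (sigma (Suc k)))"
  have "[Suc k..<Suc n] = Suc k # [Suc (Suc k)..<Suc n]"
    using assms by (simp add: upt_conv_Cons)
  then have "stage k = prod_list (map (plus_factor (partial_val sigma k)) (lex_pairs n)) *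
    ((fused k * column_prod (minus_factor (partial_val sigma k)) (Suc k)) *
      prod_list (map (column_prod (minus_factor (partial_val sigma k))) [Suc (Suc k)..<Suc n]))"
    by (simp only: stage_def list.map prod_list.Cons mult.assoc)
  moreover have "?ev (plus_factor (partial_val sigma k) ij) (plus_factor (partial_val sigma (Suc k)) ij)" for ij
    unfolding plus_factor_def split_def
    by (intro ga_evaluates_to_add ga_evaluates_to_1 ga_evaluates_to_mult ga_evaluates_to_scalar
        ga_evaluates_to_transp evaluates_to_divide evaluates_to_1 evaluates_to_add evaluates_to_partial_val
        evaluates_to_const partial_val_sum_nonzero)
  moreover have "?ev (column_prod (minus_factor (partial_val sigma k)) j)
      (column_prod (minus_factor (partial_val sigma (Suc k))) j)" if "Suc k < j" for j
    unfolding column_prod_def minus_factor_def split_def fst_conv snd_conv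
    by (intro ga_evaluates_to_prod_list ga_evaluates_to_diff ga_evaluates_to_1 ga_evaluates_to_mult
        ga_evaluates_to_scalar ga_evaluates_to_transp evaluates_to_divide evaluates_to_1 evaluates_to_diff
        evaluates_to_partial_val partial_val_diff_nonzero) (use that in auto)
  ultimately show ?thesis
    unfolding stage_def[of "Suc k"]
    by (auto intro!: ga_evaluates_to_mult ga_evaluates_to_prod_list fusion_step[OF assms] simp del: upt_Suc)
qed

lemma stage_0: "stage 0 = Omega n"
proof -
  have "subdiagram 0 = {}"
    using standard by (force simp: subdiagram_def standard_tableau_def bij_betw_def)
  then have "fused 0 = 1" by (simp add: fused_def hook_product_def)
  moreover have "plus_factor (partial_val sigma 0) =
      (\<lambda>(i, j). 1 + scalar (1 / (var i + var j + ratfun_of_cfield (omega / 2))) * transp i j)"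
    "minus_factor (partial_val sigma 0) = (\<lambda>(i, j). 1 - scalar (1 / (var i - var j)) * transp i j)"
    by (simp_all add: plus_factor_def minus_factor_def partial_val_def fun_eq_iff)
  moreover have "prod_list (map (column_prod (minus_factor (partial_val sigma 0))) [Suc 0..<Suc n]) =
      prod_list (map (minus_factor (partial_val sigma 0)) (lex_pairs n))"
    unfolding minus_factor_columns by simp
  ultimately show ?thesis by (simp only: stage_def Omega_def mult_1_left)
qed

lemma stage_n:
  "stage n = scalar (\<Prod>j\<in>{1..n}. (2 * of_int (sigma j) + ratfun_of_cfield (omega / 2)) /
      (of_int (sigma j) + ratfun_of_cfield (omega / 2))) * fused n"
proof -
  have wE: "weight_idempotent n sigma (seminormal_idem n D T)"
    by (rule seminormal_weight_idempotent[OF young standard]) (rule sigma)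
  have "jm i i * F.ext (seminormal_idem n D T) = scalar (of_int (sigma i)) * F.ext (seminormal_idem n D T)"
    if "1 \<le> i" "i \<le> n" for i
  proof -
    have "F.ext (jm i i * seminormal_idem n D T) = F.ext (scalar (of_int (sigma i)) * seminormal_idem n D T)"
      using weight_idempotent_left[OF wE that] by simp
    then show ?thesis
      by (simp add: F.ext_mult F.ext_scalar F.hom_of_int F.ext_sum F.ext_transp jm_def)
  qed
  then have weight: "jm i i * fused n = scalar (of_int (sigma i)) * fused n" if "1 \<le> i" "i \<le> n" for i
    using that unfolding fused_def subdiagram_n
    by (simp only: scalar_left_commute[of "jm i i"] scalar_left_commute[of "scalar (of_int (sigma i))"])
  have eq: "map (plus_factor (partial_val sigma n)) (lex_pairs n) =
      map (plus_factor (\<lambda>i. of_int (sigma i))) (lex_pairs n)"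
    by (auto simp: lex_pairs_def plus_factor_def partial_val_def)
  have "stage n = prod_list (map (plus_factor (partial_val sigma n)) (lex_pairs n)) * fused n"
    by (simp add: stage_def)
  then have "stage n = prod_list (map (plus_factor (\<lambda>i. of_int (sigma i))) (lex_pairs n)) * fused n"
    by (simp only: eq)
  then show ?thesis by (simp only: plus_factor_product_times_weight[OF weight])
qed

lemma content_poly_factor:
  "(\<Prod>j\<in>{1..n}. (2 * of_int (sigma j) + omega / 2) / (of_int (sigma j) + omega / 2)) =
    2 ^ n * content_poly D (omega / 4) / content_poly D (omega / 2)"
proof -
  have bij: "bij_betw T D {1..n}" using standard by (simp add: standard_tableau_def)
  then have card: "card D = n" using bij_betw_same_card by fastforce
  have "(\<Prod>j\<in>{1..n}. (2 * of_int (sigma j) + omega / 2) / (of_int (sigma j) + omega / 2)) =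
      (\<Prod>b\<in>D. (2 * of_int (sigma (T b)) + omega / 2) / (of_int (sigma (T b)) + omega / 2))"
    by (rule prod.reindex_bij_betw[OF bij, symmetric])
  also have "\<dots> = (\<Prod>b\<in>D. (2 * (omega / 4 + of_int (content b))) / (omega / 2 + of_int (content b)))"
    by (intro prod.cong refl) (simp add: sigma algebra_simps del: content.simps)
  also have "\<dots> = 2 ^ card D * content_poly D (omega / 4) / content_poly D (omega / 2)"
    unfolding content_poly_def prod_dividef prod.distrib by simp
  finally show ?thesis by (simp add: card)
qed

lemma stage_n_value:
  "stage n = R.ext (scalar (2 ^ n * content_poly D (omega / 4) * of_nat (hook_product D)
      / content_poly D (omega / 2)) * C.ext (seminormal_idem n D T))"
proof -
  have "(\<Prod>j\<in>{1..n}. (2 * of_int (sigma j) + ratfun_of_cfield (omega / 2)) /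
      (of_int (sigma j) + ratfun_of_cfield (omega / 2))) =
    ratfun_of_cfield (\<Prod>j\<in>{1..n}. (2 * of_int (sigma j) + omega / 2) / (of_int (sigma j) + omega / 2))"
    using R.hom_of_int[of 2]
    by (simp add: R.hom_prod coefficient_hom_divide[OF R.coefficient_hom_axioms] R.hom_add R.hom_mult R.hom_of_int)
  also have "\<dots> = ratfun_of_cfield (2 ^ n * content_poly D (omega / 4) / content_poly D (omega / 2))"
    by (simp only: content_poly_factor)
  finally have "stage n = scalar (ratfun_of_cfield (2 ^ n * content_poly D (omega / 4) /
      content_poly D (omega / 2)) * of_nat (hook_product D)) * F.ext (seminormal_idem n D T)"
    by (simp only: stage_n fused_def subdiagram_n scalar_mult mult.assoc)
  also have "\<dots> = R.ext (scalar (2 ^ n * content_poly D (omega / 4) / content_poly D (omega / 2)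
      * of_nat (hook_product D)) * C.ext (seminormal_idem n D T))"
    by (simp only: R.ext_mult R.ext_scalar R.hom_mult R.hom_of_nat ext_ratfun_of_complex)
  finally show ?thesis by simp
qed

end

theorem corollary2p7:
  fixes n :: nat and lam :: "nat list" and T :: "box \<Rightarrow> nat" and sigma :: "nat \<Rightarrow> int"
  assumes "partition_of n lam"
    and "standard_tableau n (diagram lam) T"
    and "\<And>i j. (i, j) \<in> diagram lam \<Longrightarrow> sigma (T (i, j)) = int j - int i"
  shows "consecutive_evaluation (map (\<lambda>k. (k, of_int (sigma k))) [1..<n+1]) (Omega n)
    (Poly_Mapping.map ratfun_of_cfield
      (scalar (2 ^ n * content_poly (diagram lam) (omega / 4) * of_nat (hook_product (diagram lam))
               / content_poly (diagram lam) (omega / 2)) *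
       Poly_Mapping.map cfield_of_complex (seminormal_idem n (diagram lam) T)))"
proof -
  interpret tableau n "diagram lam" T sigma
  proof
    show "young (diagram lam)" using assms(1) by (intro young_diagram) (simp add: partition_of_def)
    show "sigma (T b) = content b" if "b \<in> diagram lam" for b
      using assms(3) that by (cases b) simp
  qed (fact assms(2))
  have "consecutive_evaluation (map (\<lambda>k. (k, of_int (sigma k))) [Suc 0..<Suc n]) (stage 0) (stage n)"
    by (rule consecutive_evaluation_chain[OF stage_step]) auto
  then show ?thesis by (simp only: stage_0 stage_n_value Suc_eq_plus1 add_0)
qed

end
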